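(* Let $R$ be a commutative ring, let $\Gamma$ be a finite group, and let $\mathcal{Y} \le \mathcal{X}_R(\Gamma)$ be a subgroup of the $R$-character group. Let $(\varphi,\psi)$ be a morphism between two $\Gamma$-decomposition algebras $(A,\mathcal{I},\Omega_A)$ and $(B,\mathcal{J},\Omega_B)$ over $R$. Assume that $\varphi$ is surjective. Then: (i) There is a group homomorphism $\theta\colon \mathrm{Miy}_{\mathcal{Y}}(A,\mathcal{I},\Omega_A)\to \mathrm{Miy}_{\mathcal{Y}}(B,\mathcal{J},\Omega_B)$ mapping each generator $\tau_{i,\chi}$ ($i\in\mathcal{I}$, $\chi\in\mathcal{Y}$) to the generator $\tau_{\psi(i),\chi}$. (ii) Suppose that both decomposition algebras are Miyamoto-closed with respect to $\mathcal{Y}$ (so that their universal Miyamoto groups are defined). There is a group homomorphism $\widehat\theta\colon \widehat{\mathrm{Miy}}_{\mathcal{Y}}(A,\mathcal{I},\Omega_A)\to \widehat{\mathrm{Miy}}_{\mathcal{Y}}(B,\mathcal{J},\Omega_B)$ mapping each generator $t_{i,\chi}$ to the generator $t_{\psi(i),\chi}$.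
   Context: Algebras over $R$ are not assumed commutative, associative or unital. For a group $\Gamma$, a $\Gamma$-decomposition of an $R$-algebra $A$ is a direct sum decomposition of $R$-modules $A=\bigoplus_{g\in\Gamma}A_g$ with $A_gA_h\subseteq A_{gh}$ for all $g,h\in\Gamma$. A $\Gamma$-decomposition algebra is a triple $(A,\mathcal{I},\Omega)$ with $A$ an $R$-algebra, $\mathcal{I}$ an index set and $\Omega=((A^i_g)_{g\in\Gamma}\mid i\in\mathcal{I})$ a tuple of (not necessarily distinct) $\Gamma$-decompositions of $A$. A morphism $(A,\mathcal{I},\Omega_A)\to(B,\mathcal{J},\Omega_B)$ is a pair $(\varphi,\psi)$ with $\varphi\colon A\to B$ an $R$-algebra morphism and $\psi\colon\mathcal{I}\to\mathcal{J}$ a map such that $\varphi(A^i_g)\subseteq B^{\psi(i)}_g$ for all $g\in\Gamma$, $i\in\mathcal{I}$. $\mathcal{X}_R(\Gamma)$ is the group of all homomorphisms $\Gamma\to R^\times$ under pointwise multiplication. For $i\in\mathcal{I}$, $\chi\in\mathcal{X}_R(\Gamma)$, the Miyamoto map $\tau_{i,\chi}\in\mathrm{Aut}(A)$ is the $R$-linear map with $\tau_{i,\chi}(a)=\chi(g)a$ for all $a\in A^i_g$, $g\in\Gamma$. For $\mathcal{Y}\le\mathcal{X}_R(\Gamma)$, $\mathrm{Miy}_{\mathcal{Y}}(A,\mathcal{I},\Omega):=\langle\tau_{i,\chi}\mid i\in\mathcal{I},\chi\in\mathcal{Y}\rangle\le\mathrm{Aut}(A)$. $(A,\mathcal{I},\Omega)$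 is Miyamoto-closed with respect to $\mathcal{Y}$ if for each $i\in\mathcal{I}$, $\chi\in\mathcal{Y}$ there is a permutation $\pi_{i,\chi}$ of $\mathcal{I}$ with $\tau_{i,\chi}(A^j_g)=A^{\pi_{i,\chi}(j)}_g$ for all $j\in\mathcal{I}$, $g\in\Gamma$. Write ${}^{g}h:=ghg^{-1}$. Suppose $(A,\mathcal{I},\Omega)$ is Miyamoto-closed with respect to $\mathcal{Y}$. For each $i\in\mathcal{I}$ let $\mathcal{Y}_i=\{t_{i,\chi}\mid\chi\in\mathcal{Y}\}$ be a copy of the group $\mathcal{Y}$, and let $\mathcal{U}=\bigcup_{i}\mathcal{Y}_i$. For $a=t_{i,\chi}\in\mathcal{U}$ write $\overline a=\tau_{i,\chi}$ and $R_{\overline a}:=\{(j,k)\in\mathcal{I}\times\mathcal{I}\mid {}^{\overline a}\tau_{j,\chi'}=\tau_{k,\chi'}\text{ for all }\chi'\in\mathcal{Y}\}$. The universal Miyamoto group $\widehat{\mathrm{Miy}}_{\mathcal{Y}}(A,\mathcal{I},\Omega)$ is the quotient of the free product of the groups $\mathcal{Y}_i$ ($i\in\mathcal{I}$) by the relations ${}^{a}t_{j,\chi'}=t_{k,\chi'}$ for all $a\in\mathcal{U}$, all $(j,k)\in R_{\overline a}$ and all $\chi'\in\mathcal{Y}$; the image of $t_{i,\chi}$ in it is still denoted $t_{i,\chi}$. *)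

theory Defs
  imports "HOL-Algebra.Algebra"
begin

section \<open>Algebras\<close>

text \<open>
  An algebra is carried by the record type \<open>module\<close> of HOL-Algebra, which supplies addition,
  scalar multiplication and a product. The product is not assumed associative, commutative or
  unital; the field \<open>one\<close> of the record plays no role.
\<close>

locale nonassoc_algebra = module R A
  for R :: "('r, 'm) ring_scheme" (structure) and A :: "('r, 'a, 'n) module_scheme" (structure) +
  assumes amult_closed:
      "\<lbrakk>x \<in> carrier A; y \<in> carrier A\<rbrakk> \<Longrightarrow> x \<otimes>\<^bsub>A\<^esub> y \<in> carrier A"
    and amult_l_distr:
      "\<lbrakk>x \<in> carrier A; y \<in> carrier A; z \<in> carrier A\<rbrakk>
        \<Longrightarrow> (x \<oplus>\<^bsub>A\<^esub> y) \<otimes>\<^bsub>A\<^esub> z = x \<otimes>\<^bsub>A\<^esub> z \<oplus>\<^bsub>A\<^esub> y \<otimes>\<^bsub>A\<^esub> z"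
    and amult_r_distr:
      "\<lbrakk>x \<in> carrier A; y \<in> carrier A; z \<in> carrier A\<rbrakk>
        \<Longrightarrow> z \<otimes>\<^bsub>A\<^esub> (x \<oplus>\<^bsub>A\<^esub> y) = z \<otimes>\<^bsub>A\<^esub> x \<oplus>\<^bsub>A\<^esub> z \<otimes>\<^bsub>A\<^esub> y"
    and amult_l_smult:
      "\<lbrakk>r \<in> carrier R; x \<in> carrier A; y \<in> carrier A\<rbrakk>
        \<Longrightarrow> (r \<odot>\<^bsub>A\<^esub> x) \<otimes>\<^bsub>A\<^esub> y = r \<odot>\<^bsub>A\<^esub> (x \<otimes>\<^bsub>A\<^esub> y)"
    and amult_r_smult:
      "\<lbrakk>r \<in> carrier R; x \<in> carrier A; y \<in> carrier A\<rbrakk>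
        \<Longrightarrow> x \<otimes>\<^bsub>A\<^esub> (r \<odot>\<^bsub>A\<^esub> y) = r \<odot>\<^bsub>A\<^esub> (x \<otimes>\<^bsub>A\<^esub> y)"

definition linear_maps ::
    "('r, 'm) ring_scheme \<Rightarrow> ('r, 'a, 'n) module_scheme \<Rightarrow> ('r, 'b, 'k) module_scheme
      \<Rightarrow> ('a \<Rightarrow> 'b) set" where
  "linear_maps R M N = {f \<in> carrier M \<rightarrow> carrier N.
     (\<forall>x \<in> carrier M. \<forall>y \<in> carrier M. f (x \<oplus>\<^bsub>M\<^esub> y) = f x \<oplus>\<^bsub>N\<^esub> f y) \<and>
     (\<forall>r \<in> carrier R. \<forall>x \<in> carrier M. f (r \<odot>\<^bsub>M\<^esub> x) = r \<odot>\<^bsub>N\<^esub> f x)}"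

definition algebra_homs ::
    "('r, 'm) ring_scheme \<Rightarrow> ('r, 'a, 'n) module_scheme \<Rightarrow> ('r, 'b, 'k) module_scheme
      \<Rightarrow> ('a \<Rightarrow> 'b) set" where
  "algebra_homs R A B = {f \<in> linear_maps R A B.
     \<forall>x \<in> carrier A. \<forall>y \<in> carrier A. f (x \<otimes>\<^bsub>A\<^esub> y) = f x \<otimes>\<^bsub>B\<^esub> f y}"

definition algebra_Aut ::
    "('r, 'm) ring_scheme \<Rightarrow> ('r, 'a, 'n) module_scheme \<Rightarrow> ('a \<Rightarrow> 'a) monoid" where
  "algebra_Aut R A = (BijGroup (carrier A)) \<lparr>carrier := Bij (carrier A) \<inter> algebra_homs R A A\<rparr>"

section \<open>Decomposition algebras\<close>

text \<open>
  The second conjunct is the internal direct sum condition: every element is, in a unique way,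
  a finite sum of elements of the parts.
\<close>

definition algebra_decomposition ::
    "('r, 'm) ring_scheme \<Rightarrow> ('g, 'p) monoid_scheme \<Rightarrow> ('r, 'a, 'n) module_scheme
      \<Rightarrow> ('g \<Rightarrow> 'a set) \<Rightarrow> bool" where
  "algebra_decomposition R \<Gamma> A D \<longleftrightarrow>
     (\<forall>g \<in> carrier \<Gamma>. submodule (D g) R A) \<and>
     (\<forall>a \<in> carrier A. \<exists>!f. f \<in> (\<Pi>\<^sub>E g \<in> carrier \<Gamma>. D g) \<and>
        finite {g \<in> carrier \<Gamma>. f g \<noteq> \<zero>\<^bsub>A\<^esub>} \<and>
        a = finsum A f {g \<in> carrier \<Gamma>. f g \<noteq> \<zero>\<^bsub>A\<^esub>}) \<and>
     (\<forall>g \<in> carrier \<Gamma>. \<forall>h \<in> carrier \<Gamma>. \<forall>x \<in> D g. \<forall>y \<in> D h. x \<otimes>\<^bsub>A\<^esub> y \<in> D (g \<otimes>\<^bsub>\<Gamma>\<^esub> h))"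

text \<open>\<open>\<Omega> i g\<close> is the part of degree \<open>g\<close> in the decomposition with index \<open>i\<close>.\<close>

definition decomposition_algebra ::
    "('r, 'm) ring_scheme \<Rightarrow> ('g, 'p) monoid_scheme \<Rightarrow> ('r, 'a, 'n) module_scheme
      \<Rightarrow> 'i set \<Rightarrow> ('i \<Rightarrow> 'g \<Rightarrow> 'a set) \<Rightarrow> bool" where
  "decomposition_algebra R \<Gamma> A I \<Omega> \<longleftrightarrow>
     nonassoc_algebra R A \<and> (\<forall>i \<in> I. algebra_decomposition R \<Gamma> A (\<Omega> i))"

definition decomposition_algebra_morphism ::
    "('r, 'm) ring_scheme \<Rightarrow> ('g, 'p) monoid_scheme
      \<Rightarrow> ('r, 'a, 'n) module_scheme \<Rightarrow> 'i set \<Rightarrow> ('i \<Rightarrow> 'g \<Rightarrow> 'a set)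
      \<Rightarrow> ('r, 'b, 'k) module_scheme \<Rightarrow> 'j set \<Rightarrow> ('j \<Rightarrow> 'g \<Rightarrow> 'b set)
      \<Rightarrow> ('a \<Rightarrow> 'b) \<Rightarrow> ('i \<Rightarrow> 'j) \<Rightarrow> bool" where
  "decomposition_algebra_morphism R \<Gamma> A I \<Omega>\<^sub>A B J \<Omega>\<^sub>B \<phi> \<psi> \<longleftrightarrow>
     \<phi> \<in> algebra_homs R A B \<and> \<psi> \<in> I \<rightarrow> J \<and>
     (\<forall>i \<in> I. \<forall>g \<in> carrier \<Gamma>. \<phi> ` \<Omega>\<^sub>A i g \<subseteq> \<Omega>\<^sub>B (\<psi> i) g)"

section \<open>Characters and Miyamoto groups\<close>

text \<open>
  Characters and automorphisms are extensional functions, so that each is represented by exactly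
  one HOL function.
\<close>

definition character_group ::
    "('r, 'm) ring_scheme \<Rightarrow> ('g, 'p) monoid_scheme \<Rightarrow> ('g \<Rightarrow> 'r) monoid" where
  "character_group R \<Gamma> =
     \<lparr>carrier = hom \<Gamma> (units_of R) \<inter> extensional (carrier \<Gamma>),
      monoid.mult = \<lambda>\<chi> \<chi>'. \<lambda>g \<in> carrier \<Gamma>. \<chi> g \<otimes>\<^bsub>R\<^esub> \<chi>' g,
      one = \<lambda>g \<in> carrier \<Gamma>. \<one>\<^bsub>R\<^esub>\<rparr>"

definition miyamoto_map ::
    "('r, 'm) ring_scheme \<Rightarrow> ('g, 'p) monoid_scheme \<Rightarrow> ('r, 'a, 'n) module_scheme
      \<Rightarrow> ('i \<Rightarrow> 'g \<Rightarrow> 'a set) \<Rightarrow> 'i \<Rightarrow> ('g \<Rightarrow> 'r) \<Rightarrow> 'a \<Rightarrow> 'a" where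
  "miyamoto_map R \<Gamma> A \<Omega> i \<chi> =
     (THE f. f \<in> linear_maps R A A \<inter> extensional (carrier A) \<and>
        (\<forall>g \<in> carrier \<Gamma>. \<forall>a \<in> \<Omega> i g. f a = \<chi> g \<odot>\<^bsub>A\<^esub> a))"

definition miyamoto_group ::
    "('r, 'm) ring_scheme \<Rightarrow> ('g, 'p) monoid_scheme \<Rightarrow> ('g \<Rightarrow> 'r) set
      \<Rightarrow> ('r, 'a, 'n) module_scheme \<Rightarrow> 'i set \<Rightarrow> ('i \<Rightarrow> 'g \<Rightarrow> 'a set) \<Rightarrow> ('a \<Rightarrow> 'a) monoid" where
  "miyamoto_group R \<Gamma> Y A I \<Omega> =
     (algebra_Aut R A)
       \<lparr>carrier := generate (algebra_Aut R A) {miyamoto_map R \<Gamma> A \<Omega> i \<chi> | i \<chi>. i \<in> I \<and> \<chi> \<in> Y}\<rparr>"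

definition miyamoto_closed ::
    "('r, 'm) ring_scheme \<Rightarrow> ('g, 'p) monoid_scheme \<Rightarrow> ('g \<Rightarrow> 'r) set
      \<Rightarrow> ('r, 'a, 'n) module_scheme \<Rightarrow> 'i set \<Rightarrow> ('i \<Rightarrow> 'g \<Rightarrow> 'a set) \<Rightarrow> bool" where
  "miyamoto_closed R \<Gamma> Y A I \<Omega> \<longleftrightarrow>
     (\<forall>i \<in> I. \<forall>\<chi> \<in> Y. \<exists>\<pi>. bij_betw \<pi> I I \<and>
        (\<forall>j \<in> I. \<forall>g \<in> carrier \<Gamma>. miyamoto_map R \<Gamma> A \<Omega> i \<chi> ` \<Omega> j g = \<Omega> (\<pi> j) g))"

section \<open>Free products and quotients by relations\<close>

text \<open>
  The free product of the groups \<open>G i\<close> (\<open>i \<in> I\<close>) consists of the words in letters \<open>(i, x)\<close> with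
  \<open>x \<in> carrier (G i)\<close>, modulo the congruence that deletes identity letters and multiplies adjacent
  letters from the same factor.
\<close>

definition free_product_words :: "'i set \<Rightarrow> ('i \<Rightarrow> ('x, 'p) monoid_scheme) \<Rightarrow> ('i \<times> 'x) list set" where
  "free_product_words I G = lists (Sigma I (\<lambda>i. carrier (G i)))"

inductive_set free_product_rel ::
    "'i set \<Rightarrow> ('i \<Rightarrow> ('x, 'p) monoid_scheme) \<Rightarrow> (('i \<times> 'x) list \<times> ('i \<times> 'x) list) set"
  for I :: "'i set" and G :: "'i \<Rightarrow> ('x, 'p) monoid_scheme" where
  refl: "w \<in> free_product_words I G \<Longrightarrow> (w, w) \<in> free_product_rel I G"
| sym: "(v, w) \<in> free_product_rel I G \<Longrightarrow> (w, v) \<in> free_product_rel I G"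
| trans: "\<lbrakk>(u, v) \<in> free_product_rel I G; (v, w) \<in> free_product_rel I G\<rbrakk>
    \<Longrightarrow> (u, w) \<in> free_product_rel I G"
| one: "\<lbrakk>u \<in> free_product_words I G; v \<in> free_product_words I G; i \<in> I\<rbrakk>
    \<Longrightarrow> (u @ [(i, \<one>\<^bsub>G i\<^esub>)] @ v, u @ v) \<in> free_product_rel I G"
| mult: "\<lbrakk>u \<in> free_product_words I G; v \<in> free_product_words I G; i \<in> I;
      x \<in> carrier (G i); y \<in> carrier (G i)\<rbrakk>
    \<Longrightarrow> (u @ [(i, x), (i, y)] @ v, u @ [(i, x \<otimes>\<^bsub>G i\<^esub> y)] @ v) \<in> free_product_rel I G"

definition free_product ::
    "'i set \<Rightarrow> ('i \<Rightarrow> ('x, 'p) monoid_scheme) \<Rightarrow> ('i \<times> 'x) list set monoid" where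
  "free_product I G =
     \<lparr>carrier = free_product_words I G // free_product_rel I G,
      monoid.mult = \<lambda>V W. \<Union>v \<in> V. \<Union>w \<in> W. free_product_rel I G `` {v @ w},
      one = free_product_rel I G `` {[]}\<rparr>"

definition free_product_incl ::
    "'i set \<Rightarrow> ('i \<Rightarrow> ('x, 'p) monoid_scheme) \<Rightarrow> 'i \<Rightarrow> 'x \<Rightarrow> ('i \<times> 'x) list set" where
  "free_product_incl I G i x = free_product_rel I G `` {[(i, x)]}"

definition normal_closure :: "('x, 'p) monoid_scheme \<Rightarrow> 'x set \<Rightarrow> 'x set" where
  "normal_closure G S = generate G {x \<otimes>\<^bsub>G\<^esub> s \<otimes>\<^bsub>G\<^esub> inv\<^bsub>G\<^esub> x | x s. x \<in> carrier G \<and> s \<in> S}"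

section \<open>The universal Miyamoto group\<close>

definition miyamoto_conj_pairs ::
    "('r, 'm) ring_scheme \<Rightarrow> ('g, 'p) monoid_scheme \<Rightarrow> ('g \<Rightarrow> 'r) set
      \<Rightarrow> ('r, 'a, 'n) module_scheme \<Rightarrow> 'i set \<Rightarrow> ('i \<Rightarrow> 'g \<Rightarrow> 'a set)
      \<Rightarrow> ('a \<Rightarrow> 'a) \<Rightarrow> ('i \<times> 'i) set" where
  "miyamoto_conj_pairs R \<Gamma> Y A I \<Omega> \<alpha> =
     {(j, k) \<in> I \<times> I. \<forall>\<chi> \<in> Y.
        \<alpha> \<otimes>\<^bsub>algebra_Aut R A\<^esub> miyamoto_map R \<Gamma> A \<Omega> j \<chi> \<otimes>\<^bsub>algebra_Aut R A\<^esub> inv\<^bsub>algebra_Aut R A\<^esub> \<alpha>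
          = miyamoto_map R \<Gamma> A \<Omega> k \<chi>}"

text \<open>The free product of one copy of \<open>Y\<close> for each index.\<close>

definition miyamoto_free_product ::
    "('r, 'm) ring_scheme \<Rightarrow> ('g, 'p) monoid_scheme \<Rightarrow> ('g \<Rightarrow> 'r) set \<Rightarrow> 'i set
      \<Rightarrow> ('i \<times> ('g \<Rightarrow> 'r)) list set monoid" where
  "miyamoto_free_product R \<Gamma> Y I = free_product I (\<lambda>_. (character_group R \<Gamma>)\<lparr>carrier := Y\<rparr>)"

definition miyamoto_letter ::
    "('r, 'm) ring_scheme \<Rightarrow> ('g, 'p) monoid_scheme \<Rightarrow> ('g \<Rightarrow> 'r) set \<Rightarrow> 'i set
      \<Rightarrow> 'i \<Rightarrow> ('g \<Rightarrow> 'r) \<Rightarrow> ('i \<times> ('g \<Rightarrow> 'r)) list set" where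
  "miyamoto_letter R \<Gamma> Y I i \<chi> =
     free_product_incl I (\<lambda>_. (character_group R \<Gamma>)\<lparr>carrier := Y\<rparr>) i \<chi>"

text \<open>The relation that the conjugate of \<open>s\<close> by \<open>a\<close> equals \<open>t\<close> is encoded as \<open>a s a\<inverse> t\<inverse>\<close>.\<close>

definition miyamoto_relators ::
    "('r, 'm) ring_scheme \<Rightarrow> ('g, 'p) monoid_scheme \<Rightarrow> ('g \<Rightarrow> 'r) set
      \<Rightarrow> ('r, 'a, 'n) module_scheme \<Rightarrow> 'i set \<Rightarrow> ('i \<Rightarrow> 'g \<Rightarrow> 'a set)
      \<Rightarrow> ('i \<times> ('g \<Rightarrow> 'r)) list set set" where
  "miyamoto_relators R \<Gamma> Y A I \<Omega> =
     (let F = miyamoto_free_product R \<Gamma> Y I; t = miyamoto_letter R \<Gamma> Y I in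
      {t i \<chi> \<otimes>\<^bsub>F\<^esub> t j \<chi>' \<otimes>\<^bsub>F\<^esub> inv\<^bsub>F\<^esub> (t i \<chi>) \<otimes>\<^bsub>F\<^esub> inv\<^bsub>F\<^esub> (t k \<chi>') | i \<chi> j k \<chi>'.
         i \<in> I \<and> \<chi> \<in> Y \<and> \<chi>' \<in> Y \<and>
         (j, k) \<in> miyamoto_conj_pairs R \<Gamma> Y A I \<Omega> (miyamoto_map R \<Gamma> A \<Omega> i \<chi>)})"

definition universal_miyamoto_group ::
    "('r, 'm) ring_scheme \<Rightarrow> ('g, 'p) monoid_scheme \<Rightarrow> ('g \<Rightarrow> 'r) set
      \<Rightarrow> ('r, 'a, 'n) module_scheme \<Rightarrow> 'i set \<Rightarrow> ('i \<Rightarrow> 'g \<Rightarrow> 'a set)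
      \<Rightarrow> ('i \<times> ('g \<Rightarrow> 'r)) list set set monoid" where
  "universal_miyamoto_group R \<Gamma> Y A I \<Omega> =
     (let F = miyamoto_free_product R \<Gamma> Y I
      in F Mod normal_closure F (miyamoto_relators R \<Gamma> Y A I \<Omega>))"

definition universal_miyamoto_gen ::
    "('r, 'm) ring_scheme \<Rightarrow> ('g, 'p) monoid_scheme \<Rightarrow> ('g \<Rightarrow> 'r) set
      \<Rightarrow> ('r, 'a, 'n) module_scheme \<Rightarrow> 'i set \<Rightarrow> ('i \<Rightarrow> 'g \<Rightarrow> 'a set)
      \<Rightarrow> 'i \<Rightarrow> ('g \<Rightarrow> 'r) \<Rightarrow> ('i \<times> ('g \<Rightarrow> 'r)) list set set" where
  "universal_miyamoto_gen R \<Gamma> Y A I \<Omega> i \<chi> =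
     (let F = miyamoto_free_product R \<Gamma> Y I
      in normal_closure F (miyamoto_relators R \<Gamma> Y A I \<Omega>) #>\<^bsub>F\<^esub> miyamoto_letter R \<Gamma> Y I i \<chi>)"

end

theory Submission
  imports Defs
begin

text \<open>
  Let \<open>\<tau>\<close> denote the Miyamoto maps of both algebras. The key fact is the identity
  \<open>\<phi> \<circ> \<tau> i \<chi> = \<tau> (\<psi> i) \<chi> \<circ> \<phi>\<close>: both sides are linear, and on an element \<open>a\<close> of degree \<open>g\<close>
  both give \<open>\<chi> g \<cdot> \<phi> a\<close> (\<open>intertwines_miyamoto_map\<close>). As \<open>\<phi>\<close> is surjective, an automorphism
  \<open>\<alpha>\<close> of \<open>A\<close> has at most one partner \<open>\<beta>\<close> on \<open>B\<close> with \<open>\<phi> \<circ> \<alpha> = \<beta> \<circ> \<phi>\<close>. Partners can be composed and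
  inverted, so every element of the Miyamoto group of \<open>A\<close> has a partner in the Miyamoto group of
  \<open>B\<close>, and sending \<open>\<alpha>\<close> to its partner is the first homomorphism (\<open>induced_hom\<close>).

  The universal groups are given by presentations, so a homomorphism out of one of them is a
  family of homomorphisms on the copies of \<open>Y\<close> that respects the relations (\<open>U_universal\<close>, from
  the universal properties of free products and of quotients by normal closures). The family
  sends the copy of \<open>Y\<close> with index \<open>i\<close> to the one with index \<open>\<psi> i\<close>. A relation comes from an
  identity \<open>\<alpha> \<circ> \<tau> j \<chi> \<circ> \<alpha>\<inverse> = \<tau> k \<chi>\<close> for all \<open>\<chi>\<close> in \<open>Y\<close>, with \<open>\<alpha>\<close> a Miyamoto map of \<open>A\<close>; taking
  partners on both sides gives the corresponding identity for \<open>\<psi> j\<close> and \<open>\<psi> k\<close>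
  (\<open>conj_pairs_image\<close>), so relations go to relations.

  Miyamoto maps are defined by a description, so it has to be shown that they exist, are unique
  and are algebra automorphisms. This rests on one principle: linear maps that agree on the parts
  of a decomposition agree everywhere (\<open>linear_maps_eq_on_parts\<close>).
\<close>

section \<open>Free products and presentations\<close>

lemma free_product_words_append:
  "\<lbrakk>v \<in> free_product_words I G; w \<in> free_product_words I G\<rbrakk> \<Longrightarrow> v @ w \<in> free_product_words I G"
  by (simp add: free_product_words_def)

lemma free_product_words_letter:
  "\<lbrakk>i \<in> I; x \<in> carrier (G i)\<rbrakk> \<Longrightarrow> [(i, x)] \<in> free_product_words I G"
  by (simp add: free_product_words_def)

lemma free_product_words_empty: "[] \<in> free_product_words I G"
  by (simp add: free_product_words_def)

text \<open>
  The generating moves act at any place of a word, so they can be performed inside a larger word.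
  With the next lemmas on concatenation this makes the relation a congruence, so that
  multiplication of classes is well defined.
\<close>

lemma free_product_rel_context:
  assumes "(v, w) \<in> free_product_rel I G"
    and a: "a \<in> free_product_words I G" and b: "b \<in> free_product_words I G"
  shows "(a @ v @ b, a @ w @ b) \<in> free_product_rel I G"
  using assms(1)
proof induction
  case (refl w)
  then show ?case
    by (intro free_product_rel.refl free_product_words_append a b)
next
  case (sym v w)
  then show ?case by (blast intro: free_product_rel.sym)
next
  case (trans u v w)
  then show ?case by (blast intro: free_product_rel.trans)
next
  case (one u v i)
  then show ?case
    using free_product_rel.one[of "a @ u" I G "v @ b" i] a b
    by (simp add: free_product_words_append)
next
  case (mult u v i x y)
  then show ?case
    using free_product_rel.mult[of "a @ u" I G "v @ b" i x y] a b
    by (simp add: free_product_words_append)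
qed

lemma carrier_free_product:
  "carrier (free_product I G) = (\<lambda>w. free_product_rel I G `` {w}) ` free_product_words I G"
  by (auto simp: free_product_def quotient_def)

lemma one_free_product: "\<one>\<^bsub>free_product I G\<^esub> = free_product_rel I G `` {[]}"
  by (simp add: free_product_def)

locale group_family =
  fixes I :: "'i set" and G :: "'i \<Rightarrow> ('x, 'p) monoid_scheme"
  assumes group_factor: "i \<in> I \<Longrightarrow> group (G i)"
begin

lemma free_product_rel_words:
  assumes "(v, w) \<in> free_product_rel I G"
  shows "v \<in> free_product_words I G" and "w \<in> free_product_words I G"
proof -
  have "v \<in> free_product_words I G \<and> w \<in> free_product_words I G"
    using assms
  proof induction
    case (one u v i)
    interpret group "G i" using group_factor[OF one(3)] .
    show ?case
      using one by (auto simp: free_product_words_def)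
  next
    case (mult u v i x y)
    interpret group "G i" using group_factor[OF mult(3)] .
    show ?case
      using mult by (auto simp: free_product_words_def)
  qed auto
  then show "v \<in> free_product_words I G" "w \<in> free_product_words I G" by simp_all
qed

lemma equiv_free_product_rel: "equiv (free_product_words I G) (free_product_rel I G)"
proof (rule equivI)
  show "refl_on (free_product_words I G) (free_product_rel I G)"
    by (simp add: refl_on_def free_product_rel.refl)
  show "free_product_rel I G \<subseteq> free_product_words I G \<times> free_product_words I G"
    by (auto dest: free_product_rel_words)
  show "sym (free_product_rel I G)"
    by (rule symI) (rule free_product_rel.sym)
  show "trans (free_product_rel I G)"
    by (rule transI) (rule free_product_rel.trans)
qed

lemmas free_product_class_eq = equiv_class_eq[OF equiv_free_product_rel]

lemma free_product_rel_append:
  assumes v: "(v, v') \<in> free_product_rel I G" and w: "(w, w') \<in> free_product_rel I G"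
  shows "(v @ w, v' @ w') \<in> free_product_rel I G"
proof -
  have "(v @ w, v' @ w) \<in> free_product_rel I G"
    using free_product_rel_context[OF v, of "[]" w] free_product_rel_words[OF w]
    by (simp add: free_product_words_empty)
  moreover have "(v' @ w, v' @ w') \<in> free_product_rel I G"
    using free_product_rel_context[OF w, of v' "[]"] free_product_rel_words[OF v]
    by (simp add: free_product_words_empty)
  ultimately show ?thesis by (rule free_product_rel.trans)
qed

lemma mult_free_product_class:
  assumes v: "v \<in> free_product_words I G" and w: "w \<in> free_product_words I G"
  shows "(free_product_rel I G `` {v}) \<otimes>\<^bsub>free_product I G\<^esub> (free_product_rel I G `` {w})
           = free_product_rel I G `` {v @ w}"
proof -
  let ?r = "free_product_rel I G"
  have "?r `` {v' @ w'} = ?r `` {v @ w}" if "v' \<in> ?r `` {v}" "w' \<in> ?r `` {w}" for v' w'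
  proof -
    have "(v @ w, v' @ w') \<in> ?r" using that by (intro free_product_rel_append) auto
    then show ?thesis by (rule free_product_class_eq[symmetric])
  qed
  moreover have "v \<in> ?r `` {v}" "w \<in> ?r `` {w}"
    using v w by (auto intro: free_product_rel.refl)
  ultimately have "(\<Union>v' \<in> ?r `` {v}. \<Union>w' \<in> ?r `` {w}. ?r `` {v' @ w'}) = ?r `` {v @ w}"
    by blast
  then show ?thesis
    by (simp add: free_product_def)
qed

text \<open>
  Words are inverted letter by letter, in reverse order; peeling off the last letter makes the
  cancellation happen in the middle of the word.
\<close>

lemma free_product_word_inverse:
  assumes "w \<in> free_product_words I G"
  shows "\<exists>v \<in> free_product_words I G. (v @ w, []) \<in> free_product_rel I G"
  using assms
proof (induction w rule: rev_induct)
  case Nil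
  then show ?case
    using free_product_rel.refl[of "[]" I G] by force
next
  case (snoc l w)
  obtain i x where l: "l = (i, x)" by force
  have i: "i \<in> I" and x: "x \<in> carrier (G i)" and w: "w \<in> free_product_words I G"
    using snoc.prems l by (auto simp: free_product_words_def)
  interpret group "G i" using group_factor[OF i] .
  obtain v where v: "v \<in> free_product_words I G" and vw: "(v @ w, []) \<in> free_product_rel I G"
    using snoc.IH[OF w] by blast
  let ?l' = "(i, inv\<^bsub>G i\<^esub> x)"
  have "([?l'] @ (v @ w) @ [l], [?l'] @ [] @ [l]) \<in> free_product_rel I G"
    by (intro free_product_rel_context vw) (use i x l in \<open>auto intro: free_product_words_letter\<close>)
  moreover have "([] @ [?l', (i, x)] @ [], [] @ [(i, inv\<^bsub>G i\<^esub> x \<otimes>\<^bsub>G i\<^esub> x)] @ []) \<in> free_product_rel I G"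
    using i x by (intro free_product_rel.mult free_product_words_empty) auto
  moreover have "([] @ [(i, \<one>\<^bsub>G i\<^esub>)] @ [], [] @ []) \<in> free_product_rel I G"
    using i by (intro free_product_rel.one free_product_words_empty) auto
  ultimately have "(([?l'] @ v) @ w @ [l], []) \<in> free_product_rel I G"
    using x l by (auto intro: free_product_rel.trans)
  moreover have "[?l'] @ v \<in> free_product_words I G"
    using i x v by (intro free_product_words_append free_product_words_letter) auto
  ultimately show ?case by blast
qed

lemma group_free_product: "group (free_product I G)"
proof (rule groupI)
  show "\<one>\<^bsub>free_product I G\<^esub> \<in> carrier (free_product I G)"
    by (auto simp: one_free_product carrier_free_product free_product_words_empty)
next
  fix x assume "x \<in> carrier (free_product I G)"
  then obtain w where w: "w \<in> free_product_words I G" "x = free_product_rel I G `` {w}"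
    by (auto simp: carrier_free_product)
  show "\<one>\<^bsub>free_product I G\<^esub> \<otimes>\<^bsub>free_product I G\<^esub> x = x"
    using w by (simp add: one_free_product mult_free_product_class free_product_words_empty)
  obtain v where v: "v \<in> free_product_words I G" "(v @ w, []) \<in> free_product_rel I G"
    using free_product_word_inverse[OF w(1)] by blast
  have "(free_product_rel I G `` {v}) \<otimes>\<^bsub>free_product I G\<^esub> x = \<one>\<^bsub>free_product I G\<^esub>"
    using v(1) w free_product_class_eq[OF v(2)]
    by (simp add: one_free_product mult_free_product_class)
  then show "\<exists>y\<in>carrier (free_product I G). y \<otimes>\<^bsub>free_product I G\<^esub> x = \<one>\<^bsub>free_product I G\<^esub>"
    using v(1) unfolding carrier_free_product by blast
qed (auto simp: carrier_free_product mult_free_product_class free_product_words_append)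

lemma free_product_incl_hom:
  assumes i: "i \<in> I"
  shows "free_product_incl I G i \<in> hom (G i) (free_product I G)"
proof (rule homI)
  fix x y assume xy: "x \<in> carrier (G i)" "y \<in> carrier (G i)"
  have "([] @ [(i, x), (i, y)] @ [], [] @ [(i, x \<otimes>\<^bsub>G i\<^esub> y)] @ []) \<in> free_product_rel I G"
    using i xy by (intro free_product_rel.mult free_product_words_empty)
  from free_product_class_eq[OF this]
  show "free_product_incl I G i (x \<otimes>\<^bsub>G i\<^esub> y)
      = free_product_incl I G i x \<otimes>\<^bsub>free_product I G\<^esub> free_product_incl I G i y"
    using i xy
    by (simp add: free_product_incl_def mult_free_product_class free_product_words_letter)
qed (use i in \<open>auto simp: free_product_incl_def carrier_free_product free_product_words_letter\<close>)

end

text \<open>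
  A family of homomorphisms into one target group: the data from which the universal property
  produces a single homomorphism.
\<close>

locale group_family_homs = group_family I G + K: group K
  for I :: "'i set" and G :: "'i \<Rightarrow> ('x, 'p) monoid_scheme" and K :: "('k, 'q) monoid_scheme" +
  fixes h :: "'i \<Rightarrow> 'x \<Rightarrow> 'k"
  assumes hom_factor: "i \<in> I \<Longrightarrow> h i \<in> hom (G i) K"
begin

definition word_value :: "('i \<times> 'x) list \<Rightarrow> 'k" where
  "word_value w = foldr (\<lambda>(i, x) k. h i x \<otimes>\<^bsub>K\<^esub> k) w \<one>\<^bsub>K\<^esub>"

lemma word_value_simps [simp]:
  "word_value [] = \<one>\<^bsub>K\<^esub>"
  "word_value ((i, x) # w) = h i x \<otimes>\<^bsub>K\<^esub> word_value w"
  by (simp_all add: word_value_def)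

lemma factor_closed: "\<lbrakk>i \<in> I; x \<in> carrier (G i)\<rbrakk> \<Longrightarrow> h i x \<in> carrier K"
  by (rule hom_in_carrier[OF hom_factor])

lemma word_value_closed:
  "w \<in> free_product_words I G \<Longrightarrow> word_value w \<in> carrier K"
  by (induction w) (auto simp: free_product_words_def factor_closed)

lemma word_value_append:
  assumes "v \<in> free_product_words I G" and w: "w \<in> free_product_words I G"
  shows "word_value (v @ w) = word_value v \<otimes>\<^bsub>K\<^esub> word_value w"
  using assms(1)
proof (induction v)
  case Nil
  then show ?case using word_value_closed[OF w] by simp
next
  case (Cons l v)
  obtain i x where l: "l = (i, x)" by force
  have i: "i \<in> I" and x: "x \<in> carrier (G i)" and v: "v \<in> free_product_words I G"
    using Cons.prems l by (auto simp: free_product_words_def)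
  show ?case
    using Cons.IH[OF v] word_value_closed[OF v] word_value_closed[OF w] factor_closed[OF i x]
    by (simp add: l K.m_assoc)
qed

text \<open>
  The two generating moves of the congruence, deleting an identity letter and multiplying adjacent
  letters of one factor, do not change the value because each \<open>h i\<close> is a homomorphism.
\<close>

lemma word_value_free_product_rel:
  assumes "(v, w) \<in> free_product_rel I G"
  shows "word_value v = word_value w"
  using assms
proof induction
  case (one u v i)
  interpret Gi: group "G i" using group_factor[OF one(3)] .
  have "h i \<one>\<^bsub>G i\<^esub> = \<one>\<^bsub>K\<^esub>"
    using hom_one[OF hom_factor[OF one(3)]] by blast
  moreover have "(i, \<one>\<^bsub>G i\<^esub>) # v \<in> free_product_words I G"
    using one by (simp add: free_product_words_def)
  ultimately show ?case
    using one word_value_closed[OF one(2)]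
    by (simp add: word_value_append)
next
  case (mult u v i x y)
  interpret Gi: group "G i" using group_factor[OF mult(3)] .
  have "(i, x) # (i, y) # v \<in> free_product_words I G"
    "(i, x \<otimes>\<^bsub>G i\<^esub> y) # v \<in> free_product_words I G"
    using mult by (auto simp: free_product_words_def)
  then show ?case
    using mult hom_mult[OF hom_factor[OF mult(3)] mult(4,5)] word_value_closed[OF mult(2)]
    by (simp add: word_value_append factor_closed K.m_assoc)
qed auto

text \<open>
  The value of a word depends only on its class, so evaluation is a map on the free product; this
  is the existence half of its universal property as a coproduct.
\<close>

lemma free_product_universal:
  obtains f where "f \<in> hom (free_product I G) K"
    and "\<And>i x. \<lbrakk>i \<in> I; x \<in> carrier (G i)\<rbrakk> \<Longrightarrow> f (free_product_incl I G i x) = h i x"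
proof -
  let ?r = "free_product_rel I G"
  \<comment> \<open>Evaluation is constant on each class, so the image of a class is a singleton.\<close>
  define f where "f V = the_elem (word_value ` V)" for V
  have f: "f (?r `` {w}) = word_value w" if "w \<in> free_product_words I G" for w
  proof -
    have "\<forall>v \<in> ?r `` {w}. word_value v = word_value w"
      using word_value_free_product_rel by auto
    moreover have "w \<in> ?r `` {w}"
      using that by (auto intro: free_product_rel.refl)
    ultimately have "word_value ` (?r `` {w}) = {word_value w}"
      by blast
    then show ?thesis by (simp add: f_def)
  qed
  have "f \<in> hom (free_product I G) K"
    by (rule homI) (auto simp: carrier_free_product mult_free_product_class f
        free_product_words_append word_value_append word_value_closed)
  moreover have "f (free_product_incl I G i x) = h i x" if "i \<in> I" "x \<in> carrier (G i)" for i x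
    using that f[of "[(i, x)]"] factor_closed[OF that]
    by (simp add: free_product_incl_def free_product_words_letter)
  ultimately show thesis by (rule that)
qed

end

text \<open>
  Conjugating a conjugate of \<open>s\<close> gives another conjugate of \<open>s\<close>; the generating set is thus stable
  under conjugation, and so is the subgroup that it generates.
\<close>

lemma (in group) normal_closure_normal:
  assumes S: "S \<subseteq> carrier G"
  shows "normal_closure G S \<lhd> G"
proof -
  let ?C = "{x \<otimes> s \<otimes> inv x | x s. x \<in> carrier G \<and> s \<in> S}"
  show ?thesis
    unfolding normal_closure_def
  proof (rule normal_generateI)
    show "?C \<subseteq> carrier G" using S by auto
    fix c g assume "c \<in> ?C" and g: "g \<in> carrier G"
    then obtain x s where xs: "x \<in> carrier G" "s \<in> S" "c = x \<otimes> s \<otimes> inv x" by auto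
    then have "g \<otimes> c \<otimes> inv g = (g \<otimes> x) \<otimes> s \<otimes> inv (g \<otimes> x)"
      using g S by (auto simp: m_assoc inv_mult_group subset_iff)
    moreover have "g \<otimes> x \<in> carrier G" using g xs by simp
    ultimately show "g \<otimes> c \<otimes> inv g \<in> ?C"
      using xs(2) by blast
  qed
qed

lemma (in group) subset_normal_closure:
  assumes S: "S \<subseteq> carrier G"
  shows "S \<subseteq> normal_closure G S"
proof
  fix s assume "s \<in> S"
  moreover from this have "s = \<one> \<otimes> s \<otimes> inv \<one>" using S by auto
  ultimately show "s \<in> normal_closure G S"
    unfolding normal_closure_def by (blast intro: generate.incl)
qed

text \<open>
  The kernel is normal, so with the relators it contains all their conjugates and the subgroup that
  these generate. This is von Dyck's principle for homomorphisms out of a presented group.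
\<close>

lemma (in group_hom) normal_closure_quotient_universal:
  assumes S: "S \<subseteq> carrier G" and trivial: "\<And>s. s \<in> S \<Longrightarrow> h s = \<one>\<^bsub>H\<^esub>"
  obtains f where "f \<in> hom (G Mod normal_closure G S) H"
    and "\<And>g. g \<in> carrier G \<Longrightarrow> f (normal_closure G S #> g) = h g"
proof -
  have "{x \<otimes> s \<otimes> inv x | x s. x \<in> carrier G \<and> s \<in> S} \<subseteq> kernel G H h"
    using S trivial by (auto simp: kernel_def subset_iff)
  then have "normal_closure G S \<subseteq> kernel G H h"
    unfolding normal_closure_def by (rule G.generate_subgroup_incl[OF _ subgroup_kernel])
  then show thesis
    using FactGroup_universal_kernel[OF G.normal_closure_normal[OF S]] that by metis
qed

section \<open>Linear maps and homogeneous components\<close>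

lemma linear_mapsD:
  assumes "f \<in> linear_maps R M N"
  shows "x \<in> carrier M \<Longrightarrow> f x \<in> carrier N"
    and "\<lbrakk>x \<in> carrier M; y \<in> carrier M\<rbrakk> \<Longrightarrow> f (x \<oplus>\<^bsub>M\<^esub> y) = f x \<oplus>\<^bsub>N\<^esub> f y"
    and "\<lbrakk>r \<in> carrier R; x \<in> carrier M\<rbrakk> \<Longrightarrow> f (r \<odot>\<^bsub>M\<^esub> x) = r \<odot>\<^bsub>N\<^esub> f x"
  using assms by (auto simp: linear_maps_def)

lemma linear_maps_compose:
  "\<lbrakk>f \<in> linear_maps R M N; g \<in> linear_maps R N P\<rbrakk> \<Longrightarrow> (\<lambda>x. g (f x)) \<in> linear_maps R M P"
  unfolding linear_maps_def by (auto simp: Pi_iff)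

lemma linear_maps_finsum:
  assumes "module R M" and "module R N" and f: "f \<in> linear_maps R M N"
    and "finite S" and "s \<in> S \<rightarrow> carrier M"
  shows "f (finsum M s S) = finsum N (\<lambda>i. f (s i)) S"
proof -
  interpret M: module R M by fact
  interpret N: module R N by fact
  note f = linear_mapsD[OF f]
  show ?thesis
    using assms(4,5)
  proof (induction S)
    case empty
    have "f (\<zero>\<^bsub>R\<^esub> \<odot>\<^bsub>M\<^esub> \<zero>\<^bsub>M\<^esub>) = \<zero>\<^bsub>N\<^esub>"
      using f(1)[of "\<zero>\<^bsub>M\<^esub>"] f(3)[of "\<zero>\<^bsub>R\<^esub>" "\<zero>\<^bsub>M\<^esub>"] by simp
    then show ?case by simp
  next
    case (insert i S)
    then have "s i \<in> carrier M" "s \<in> S \<rightarrow> carrier M" "(\<lambda>i. f (s i)) \<in> S \<rightarrow> carrier N"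
      using f(1) by auto
    with insert show ?case using f by simp
  qed
qed

locale finite_decomposition =
  nonassoc_algebra R A + \<Gamma>: group \<Gamma>
  for R :: "('r, 'm) ring_scheme" (structure) and A :: "('r, 'a, 'n) module_scheme" (structure)
    and \<Gamma> :: "('g, 'p) monoid_scheme" +
  fixes D :: "'g \<Rightarrow> 'a set"
  assumes finite_degrees: "finite (carrier \<Gamma>)"
    and decomposition: "algebra_decomposition R \<Gamma> A D"
begin

lemma part_submodule: "g \<in> carrier \<Gamma> \<Longrightarrow> submodule (D g) R A"
  using decomposition by (simp add: algebra_decomposition_def)

lemma part_closed: "\<lbrakk>g \<in> carrier \<Gamma>; a \<in> D g\<rbrakk> \<Longrightarrow> a \<in> carrier A"
  using submoduleE(1)[OF part_submodule] by blast

lemma part_zero: "g \<in> carrier \<Gamma> \<Longrightarrow> \<zero>\<^bsub>A\<^esub> \<in> D g"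
  using subgroup.one_closed[OF submodule.axioms(1)[OF part_submodule]] by simp

lemma part_mult:
  "\<lbrakk>g \<in> carrier \<Gamma>; h \<in> carrier \<Gamma>; a \<in> D g; b \<in> D h\<rbrakk> \<Longrightarrow> a \<otimes>\<^bsub>A\<^esub> b \<in> D (g \<otimes>\<^bsub>\<Gamma>\<^esub> h)"
  using decomposition by (simp add: algebra_decomposition_def)

lemma parts_into_carrier: "f \<in> (\<Pi>\<^sub>E g \<in> carrier \<Gamma>. D g) \<Longrightarrow> f \<in> carrier \<Gamma> \<rightarrow> carrier A"
  using part_closed by (auto simp: PiE_iff)

text \<open>
  As there are finitely many degrees, the sum over the support of a family of components is the
  sum over all degrees.
\<close>

lemma ex1_components:
  assumes "a \<in> carrier A"
  shows "\<exists>!f. f \<in> (\<Pi>\<^sub>E g \<in> carrier \<Gamma>. D g) \<and> a = finsum A f (carrier \<Gamma>)"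
proof -
  have "finsum A f {g \<in> carrier \<Gamma>. f g \<noteq> \<zero>\<^bsub>A\<^esub>} = finsum A f (carrier \<Gamma>)"
    if "f \<in> (\<Pi>\<^sub>E g \<in> carrier \<Gamma>. D g)" for f
    using parts_into_carrier[OF that] finite_degrees
    by (intro M.add.finprod_mono_neutral_cong_left) auto
  then have "f \<in> (\<Pi>\<^sub>E g \<in> carrier \<Gamma>. D g) \<and> finite {g \<in> carrier \<Gamma>. f g \<noteq> \<zero>\<^bsub>A\<^esub>} \<and>
        a = finsum A f {g \<in> carrier \<Gamma>. f g \<noteq> \<zero>\<^bsub>A\<^esub>} \<longleftrightarrow>
      f \<in> (\<Pi>\<^sub>E g \<in> carrier \<Gamma>. D g) \<and> a = finsum A f (carrier \<Gamma>)" for f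
    using finite_degrees by auto
  moreover have "\<exists>!f. f \<in> (\<Pi>\<^sub>E g \<in> carrier \<Gamma>. D g) \<and> finite {g \<in> carrier \<Gamma>. f g \<noteq> \<zero>\<^bsub>A\<^esub>} \<and>
        a = finsum A f {g \<in> carrier \<Gamma>. f g \<noteq> \<zero>\<^bsub>A\<^esub>}"
    using decomposition assms by (simp only: algebra_decomposition_def)
  ultimately show ?thesis by simp
qed

definition components :: "'a \<Rightarrow> 'g \<Rightarrow> 'a" where
  "components a = (THE f. f \<in> (\<Pi>\<^sub>E g \<in> carrier \<Gamma>. D g) \<and> a = finsum A f (carrier \<Gamma>))"

lemma components:
  assumes "a \<in> carrier A"
  shows "components a \<in> (\<Pi>\<^sub>E g \<in> carrier \<Gamma>. D g)" and "finsum A (components a) (carrier \<Gamma>) = a"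
  using theI'[OF ex1_components[OF assms]] by (simp_all add: components_def)

lemma components_eqI:
  assumes "f \<in> (\<Pi>\<^sub>E g \<in> carrier \<Gamma>. D g)" and "finsum A f (carrier \<Gamma>) = a"
  shows "components a = f"
proof -
  have "a \<in> carrier A"
    using parts_into_carrier[OF assms(1)] assms(2) by auto
  then show ?thesis
    unfolding components_def using assms by (intro the1_equality ex1_components) auto
qed

text \<open>
  The parts span the algebra. This lemma carries all later identities between linear maps: each
  of them is checked on homogeneous elements, where Miyamoto maps act as scalars.
\<close>

lemma linear_maps_eq_on_parts:
  assumes N: "module R N" and f: "f \<in> linear_maps R A N" and f': "f' \<in> linear_maps R A N"
    and eq: "\<And>g a. \<lbrakk>g \<in> carrier \<Gamma>; a \<in> D g\<rbrakk> \<Longrightarrow> f a = f' a"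
    and a: "a \<in> carrier A"
  shows "f a = f' a"
proof -
  interpret N: module R N by fact
  let ?c = "components a"
  have c: "?c \<in> carrier \<Gamma> \<rightarrow> carrier A" and c_part: "\<And>g. g \<in> carrier \<Gamma> \<Longrightarrow> ?c g \<in> D g"
    using components(1)[OF a] parts_into_carrier by auto
  have "f a = f (finsum A ?c (carrier \<Gamma>))"
    using components(2)[OF a] by simp
  also have "\<dots> = finsum N (\<lambda>g. f (?c g)) (carrier \<Gamma>)"
    by (rule linear_maps_finsum[OF module_axioms N f finite_degrees c])
  also have "\<dots> = finsum N (\<lambda>g. f' (?c g)) (carrier \<Gamma>)"
    using eq c_part funcset_mem[OF c] linear_mapsD(1)[OF f'] by (intro N.M.finsum_cong') auto
  also have "\<dots> = f' (finsum A ?c (carrier \<Gamma>))"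
    by (rule linear_maps_finsum[OF module_axioms N f' finite_degrees c, symmetric])
  also have "\<dots> = f' a"
    using components(2)[OF a] by simp
  finally show ?thesis .
qed

text \<open>
  By uniqueness of components, a family in the parts that sums to the right element is its family
  of components. The three computations below all rest on this. The first two make scaling by
  degree linear; the third shows how it acts on homogeneous elements.
\<close>

lemma components_add:
  assumes a: "a \<in> carrier A" and b: "b \<in> carrier A"
  shows "components (a \<oplus>\<^bsub>A\<^esub> b) = (\<lambda>g \<in> carrier \<Gamma>. components a g \<oplus>\<^bsub>A\<^esub> components b g)"
proof (rule components_eqI)
  note c = components[OF a] components[OF b]
  show "(\<lambda>g \<in> carrier \<Gamma>. components a g \<oplus>\<^bsub>A\<^esub> components b g) \<in> (\<Pi>\<^sub>E g \<in> carrier \<Gamma>. D g)"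
    using c(1,3) submoduleE(5)[OF part_submodule] by (auto simp: PiE_iff)
  have "finsum A (\<lambda>g \<in> carrier \<Gamma>. components a g \<oplus>\<^bsub>A\<^esub> components b g) (carrier \<Gamma>)
      = finsum A (\<lambda>g. components a g \<oplus>\<^bsub>A\<^esub> components b g) (carrier \<Gamma>)"
    using c(1,3)[THEN parts_into_carrier] by (intro M.finsum_cong') auto
  also have "\<dots> = a \<oplus>\<^bsub>A\<^esub> b"
    using c(1,3)[THEN parts_into_carrier] c(2,4) by (simp add: M.finsum_addf)
  finally show "finsum A (\<lambda>g \<in> carrier \<Gamma>. components a g \<oplus>\<^bsub>A\<^esub> components b g) (carrier \<Gamma>)
      = a \<oplus>\<^bsub>A\<^esub> b" .
qed

lemma components_smult:
  assumes r: "r \<in> carrier R" and a: "a \<in> carrier A"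
  shows "components (r \<odot>\<^bsub>A\<^esub> a) = (\<lambda>g \<in> carrier \<Gamma>. r \<odot>\<^bsub>A\<^esub> components a g)"
proof (rule components_eqI)
  note c = components[OF a]
  show "(\<lambda>g \<in> carrier \<Gamma>. r \<odot>\<^bsub>A\<^esub> components a g) \<in> (\<Pi>\<^sub>E g \<in> carrier \<Gamma>. D g)"
    using c(1) r submoduleE(4)[OF part_submodule] by (auto simp: PiE_iff)
  have "finsum A (\<lambda>g \<in> carrier \<Gamma>. r \<odot>\<^bsub>A\<^esub> components a g) (carrier \<Gamma>)
      = finsum A (\<lambda>g. r \<odot>\<^bsub>A\<^esub> components a g) (carrier \<Gamma>)"
    using parts_into_carrier[OF c(1)] r by (intro M.finsum_cong') auto
  also have "\<dots> = r \<odot>\<^bsub>A\<^esub> a"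
    using finsum_smult_ldistr[OF finite_degrees r parts_into_carrier[OF c(1)]] c(2) by simp
  finally show "finsum A (\<lambda>g \<in> carrier \<Gamma>. r \<odot>\<^bsub>A\<^esub> components a g) (carrier \<Gamma>) = r \<odot>\<^bsub>A\<^esub> a" .
qed

lemma components_homogeneous:
  assumes g: "g \<in> carrier \<Gamma>" and a: "a \<in> D g"
  shows "components a = (\<lambda>h \<in> carrier \<Gamma>. if h = g then a else \<zero>\<^bsub>A\<^esub>)"
proof (rule components_eqI)
  show "(\<lambda>h \<in> carrier \<Gamma>. if h = g then a else \<zero>\<^bsub>A\<^esub>) \<in> (\<Pi>\<^sub>E g \<in> carrier \<Gamma>. D g)"
    using a part_zero by auto
  have "finsum A (\<lambda>h \<in> carrier \<Gamma>. if h = g then a else \<zero>\<^bsub>A\<^esub>) (carrier \<Gamma>)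
      = finsum A (\<lambda>h. if h = g then a else \<zero>\<^bsub>A\<^esub>) (carrier \<Gamma>)"
    using part_closed[OF g a] by (intro M.finsum_cong') auto
  also have "\<dots> = a"
    using M.add.finprod_singleton_swap[OF g finite_degrees, of "\<lambda>_. a"] part_closed[OF g a] by simp
  finally show "finsum A (\<lambda>h \<in> carrier \<Gamma>. if h = g then a else \<zero>\<^bsub>A\<^esub>) (carrier \<Gamma>) = a" .
qed

text \<open>
  The witness multiplies each component by its scalar and sums up again. It is linear because the
  components depend linearly on the element.
\<close>

lemma ex_scaling_map:
  assumes \<chi>: "\<chi> \<in> carrier \<Gamma> \<rightarrow> carrier R"
  shows "\<exists>f \<in> linear_maps R A A \<inter> extensional (carrier A).
    \<forall>g \<in> carrier \<Gamma>. \<forall>a \<in> D g. f a = \<chi> g \<odot>\<^bsub>A\<^esub> a"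
proof
  let ?f = "\<lambda>a \<in> carrier A. finsum A (\<lambda>g. \<chi> g \<odot>\<^bsub>A\<^esub> components a g) (carrier \<Gamma>)"
  have c: "components a g \<in> carrier A" if "a \<in> carrier A" "g \<in> carrier \<Gamma>" for a g
    using parts_into_carrier[OF components(1)[OF that(1)]] that(2) by auto
  have \<chi>g: "\<chi> g \<in> carrier R" if "g \<in> carrier \<Gamma>" for g using \<chi> that by auto
  have "?f (a \<oplus>\<^bsub>A\<^esub> b) = ?f a \<oplus>\<^bsub>A\<^esub> ?f b" if "a \<in> carrier A" "b \<in> carrier A" for a b
  proof -
    have "finsum A (\<lambda>g. \<chi> g \<odot>\<^bsub>A\<^esub> components (a \<oplus>\<^bsub>A\<^esub> b) g) (carrier \<Gamma>)
      = finsum A (\<lambda>g. \<chi> g \<odot>\<^bsub>A\<^esub> components a g \<oplus>\<^bsub>A\<^esub> \<chi> g \<odot>\<^bsub>A\<^esub> components b g) (carrier \<Gamma>)"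
      using that c \<chi>g by (intro M.finsum_cong') (auto simp: components_add smult_r_distr)
    then show ?thesis using that c \<chi>g by (simp add: M.finsum_addf Pi_iff)
  qed
  moreover have "?f (r \<odot>\<^bsub>A\<^esub> a) = r \<odot>\<^bsub>A\<^esub> ?f a" if "r \<in> carrier R" "a \<in> carrier A" for r a
  proof -
    have "finsum A (\<lambda>g. \<chi> g \<odot>\<^bsub>A\<^esub> components (r \<odot>\<^bsub>A\<^esub> a) g) (carrier \<Gamma>)
      = finsum A (\<lambda>g. r \<odot>\<^bsub>A\<^esub> (\<chi> g \<odot>\<^bsub>A\<^esub> components a g)) (carrier \<Gamma>)"
      using that c \<chi>g
      by (intro M.finsum_cong') (auto simp: components_smult R.m_comm simp flip: smult_assoc1)
    then show ?thesis
      using that c \<chi>g finsum_smult_ldistr[OF finite_degrees that(1)] by (simp add: Pi_iff)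
  qed
  moreover have "?f \<in> carrier A \<rightarrow> carrier A"
    using c \<chi>g by (auto intro!: M.finsum_closed)
  ultimately show "?f \<in> linear_maps R A A \<inter> extensional (carrier A)"
    by (simp add: linear_maps_def)
  show "\<forall>g \<in> carrier \<Gamma>. \<forall>a \<in> D g. ?f a = \<chi> g \<odot>\<^bsub>A\<^esub> a"
  proof (intro ballI)
    fix g a assume g: "g \<in> carrier \<Gamma>" and a: "a \<in> D g"
    note aA = part_closed[OF g a]
    have "finsum A (\<lambda>h. \<chi> h \<odot>\<^bsub>A\<^esub> components a h) (carrier \<Gamma>)
      = finsum A (\<lambda>h. if h = g then \<chi> g \<odot>\<^bsub>A\<^esub> a else \<zero>\<^bsub>A\<^esub>) (carrier \<Gamma>)"
      using aA \<chi>g g by (intro M.finsum_cong') (auto simp: components_homogeneous[OF g a])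
    also have "\<dots> = \<chi> g \<odot>\<^bsub>A\<^esub> a"
      using M.add.finprod_singleton_swap[OF g finite_degrees, of "\<lambda>_. \<chi> g \<odot>\<^bsub>A\<^esub> a"] aA \<chi>g[OF g]
      by simp
    finally show "?f a = \<chi> g \<odot>\<^bsub>A\<^esub> a" using aA by simp
  qed
qed

end

section \<open>Algebra automorphisms\<close>

lemma linear_algebra_hom: "f \<in> algebra_homs R A B \<Longrightarrow> f \<in> linear_maps R A B"
  by (simp add: algebra_homs_def)

context nonassoc_algebra
begin

text \<open>
  The point to see is closure under inverses: the inverse of a bijection that respects an operation
  respects it as well.
\<close>

lemma subgroup_algebra_Aut: "subgroup (Bij (carrier A) \<inter> algebra_homs R A A) (BijGroup (carrier A))"
proof (rule group.subgroupI[OF group_BijGroup])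
  show "Bij (carrier A) \<inter> algebra_homs R A A \<subseteq> carrier (BijGroup (carrier A))"
    by (auto simp: BijGroup_def)
  have "(\<lambda>x \<in> carrier A. x) \<in> algebra_homs R A A"
    by (auto simp: algebra_homs_def linear_maps_def amult_closed)
  then show "Bij (carrier A) \<inter> algebra_homs R A A \<noteq> {}"
    using id_Bij[of "carrier A"] by blast
next
  fix f assume f: "f \<in> Bij (carrier A) \<inter> algebra_homs R A A"
  let ?f' = "inv_into (carrier A) f"
  have bij: "bij_betw f (carrier A) (carrier A)" using f by (auto simp: Bij_def)
  have f': "?f' x \<in> carrier A" "f (?f' x) = x" if "x \<in> carrier A" for x
    using that bij bij_betw_inv_into_right[OF bij] f by (auto simp: Bij_inv_into_mem)
  have "?f' (x \<oplus>\<^bsub>A\<^esub> y) = ?f' x \<oplus>\<^bsub>A\<^esub> ?f' y \<and> ?f' (x \<otimes>\<^bsub>A\<^esub> y) = ?f' x \<otimes>\<^bsub>A\<^esub> ?f' y"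
    if "x \<in> carrier A" "y \<in> carrier A" for x y
    using that f by (intro conjI Bij_inv_into_lemma)
      (auto simp: algebra_homs_def linear_maps_def amult_closed)
  moreover have "?f' (r \<odot>\<^bsub>A\<^esub> x) = r \<odot>\<^bsub>A\<^esub> ?f' x" if "r \<in> carrier R" "x \<in> carrier A" for r x
  proof -
    have "f (r \<odot>\<^bsub>A\<^esub> ?f' x) = r \<odot>\<^bsub>A\<^esub> x"
      using that f f' by (auto simp: algebra_homs_def linear_maps_def)
    then show ?thesis
      using that f'(1) bij_betw_inv_into_left[OF bij, of "r \<odot>\<^bsub>A\<^esub> ?f' x"] by simp
  qed
  ultimately have "restrict ?f' (carrier A) \<in> algebra_homs R A A"
    using f'(1) by (simp add: algebra_homs_def linear_maps_def amult_closed)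
  then show "inv\<^bsub>BijGroup (carrier A)\<^esub> f \<in> Bij (carrier A) \<inter> algebra_homs R A A"
    using f by (simp add: inv_BijGroup restrict_inv_into_Bij)
next
  fix f g assume fg: "f \<in> Bij (carrier A) \<inter> algebra_homs R A A" "g \<in> Bij (carrier A) \<inter> algebra_homs R A A"
  then have "compose (carrier A) f g \<in> algebra_homs R A A"
    by (auto simp: algebra_homs_def linear_maps_def compose_def amult_closed Pi_iff)
  then show "f \<otimes>\<^bsub>BijGroup (carrier A)\<^esub> g \<in> Bij (carrier A) \<inter> algebra_homs R A A"
    using fg by (simp add: BijGroup_def compose_Bij)
qed

lemma group_algebra_Aut: "group (algebra_Aut R A)"
  unfolding algebra_Aut_def by (rule subgroup.subgroup_is_group[OF subgroup_algebra_Aut group_BijGroup])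

lemma carrier_algebra_Aut: "carrier (algebra_Aut R A) = Bij (carrier A) \<inter> algebra_homs R A A"
  by (simp add: algebra_Aut_def)

lemma algebra_Aut_closed:
  "\<lbrakk>\<alpha> \<in> carrier (algebra_Aut R A); a \<in> carrier A\<rbrakk> \<Longrightarrow> \<alpha> a \<in> carrier A"
  using Bij_imp_funcset[of \<alpha>] by (auto simp: carrier_algebra_Aut)

lemma algebra_Aut_extensional: "\<alpha> \<in> carrier (algebra_Aut R A) \<Longrightarrow> \<alpha> \<in> extensional (carrier A)"
  by (simp add: carrier_algebra_Aut Bij_def)

lemma algebra_Aut_apply:
  "a \<in> carrier A \<Longrightarrow> \<one>\<^bsub>algebra_Aut R A\<^esub> a = a"
  "\<lbrakk>\<alpha> \<in> carrier (algebra_Aut R A); \<beta> \<in> carrier (algebra_Aut R A); a \<in> carrier A\<rbrakk>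
    \<Longrightarrow> (\<alpha> \<otimes>\<^bsub>algebra_Aut R A\<^esub> \<beta>) a = \<alpha> (\<beta> a)"
  by (simp_all add: algebra_Aut_def BijGroup_def compose_def)

lemma algebra_Aut_inv_apply:
  assumes "\<alpha> \<in> carrier (algebra_Aut R A)" and "a \<in> carrier A"
  shows "\<alpha> ((inv\<^bsub>algebra_Aut R A\<^esub> \<alpha>) a) = a" and "(inv\<^bsub>algebra_Aut R A\<^esub> \<alpha>) (\<alpha> a) = a"
proof -
  interpret Aut: group "algebra_Aut R A" by (rule group_algebra_Aut)
  have "inv\<^bsub>algebra_Aut R A\<^esub> \<alpha> \<in> carrier (algebra_Aut R A)" using assms by simp
  then show "\<alpha> ((inv\<^bsub>algebra_Aut R A\<^esub> \<alpha>) a) = a" "(inv\<^bsub>algebra_Aut R A\<^esub> \<alpha>) (\<alpha> a) = a"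
    using assms by (simp_all flip: algebra_Aut_apply(2) add: algebra_Aut_apply(1))
qed

end

section \<open>Miyamoto maps\<close>

text \<open>
  Inverses of characters are taken pointwise in the unit group. They are again multiplicative
  because the unit group of a commutative ring is commutative.
\<close>

lemma group_character_group:
  assumes "cring R" and "group \<Gamma>"
  shows "group (character_group R \<Gamma>)"
proof -
  interpret R: cring R by fact
  interpret \<Gamma>: group \<Gamma> by fact
  interpret U: comm_group "units_of R" by (rule R.units_comm_group)
  have U_simps: "carrier (units_of R) = Units R" "x \<otimes>\<^bsub>units_of R\<^esub> y = x \<otimes>\<^bsub>R\<^esub> y" for x y
    by (simp_all add: units_of_def)
  note unit = R.Units_closed
  show ?thesis
  proof (rule groupI)
    fix \<chi> \<chi>' assume "\<chi> \<in> carrier (character_group R \<Gamma>)" "\<chi>' \<in> carrier (character_group R \<Gamma>)"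
    then show "\<chi> \<otimes>\<^bsub>character_group R \<Gamma>\<^esub> \<chi>' \<in> carrier (character_group R \<Gamma>)"
      by (auto simp: character_group_def hom_def Pi_iff U_simps unit R.m_ac)
  next
    show "\<one>\<^bsub>character_group R \<Gamma>\<^esub> \<in> carrier (character_group R \<Gamma>)"
      by (auto simp: character_group_def hom_def U_simps)
  next
    fix \<chi> \<chi>' \<chi>'' assume "\<chi> \<in> carrier (character_group R \<Gamma>)" "\<chi>' \<in> carrier (character_group R \<Gamma>)"
      "\<chi>'' \<in> carrier (character_group R \<Gamma>)"
    then show "\<chi> \<otimes>\<^bsub>character_group R \<Gamma>\<^esub> \<chi>' \<otimes>\<^bsub>character_group R \<Gamma>\<^esub> \<chi>''
        = \<chi> \<otimes>\<^bsub>character_group R \<Gamma>\<^esub> (\<chi>' \<otimes>\<^bsub>character_group R \<Gamma>\<^esub> \<chi>'')"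
      by (auto simp: character_group_def hom_def Pi_iff U_simps unit R.m_assoc)
  next
    fix \<chi> assume "\<chi> \<in> carrier (character_group R \<Gamma>)"
    then show "\<one>\<^bsub>character_group R \<Gamma>\<^esub> \<otimes>\<^bsub>character_group R \<Gamma>\<^esub> \<chi> = \<chi>"
      by (auto simp: character_group_def hom_def Pi_iff U_simps unit extensional_def)
  next
    fix \<chi> assume "\<chi> \<in> carrier (character_group R \<Gamma>)"
    then have \<chi>: "\<chi> \<in> hom \<Gamma> (units_of R)" by (simp add: character_group_def)
    note \<chi>U = hom_in_carrier[OF \<chi>]
    let ?\<chi>' = "\<lambda>g \<in> carrier \<Gamma>. inv\<^bsub>units_of R\<^esub> \<chi> g"
    have "?\<chi>' \<in> carrier (character_group R \<Gamma>)"
      using \<chi>U hom_mult[OF \<chi>]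
      by (auto simp: character_group_def U.inv_mult intro!: homI)
    moreover have "?\<chi>' \<otimes>\<^bsub>character_group R \<Gamma>\<^esub> \<chi> = \<one>\<^bsub>character_group R \<Gamma>\<^esub>"
    proof -
      have "inv\<^bsub>units_of R\<^esub> \<chi> g \<otimes>\<^bsub>R\<^esub> \<chi> g = \<one>\<^bsub>R\<^esub>" if "g \<in> carrier \<Gamma>" for g
        using U.l_inv[OF \<chi>U[OF that]] by (simp add: units_of_def)
      then show ?thesis by (auto simp: character_group_def fun_eq_iff)
    qed
    ultimately show "\<exists>\<chi>'\<in>carrier (character_group R \<Gamma>).
        \<chi>' \<otimes>\<^bsub>character_group R \<Gamma>\<^esub> \<chi> = \<one>\<^bsub>character_group R \<Gamma>\<^esub>" by blast
  qed
qed

lemma (in cring) character_closed: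
  "\<lbrakk>\<chi> \<in> carrier (character_group R \<Gamma>); g \<in> carrier \<Gamma>\<rbrakk> \<Longrightarrow> \<chi> g \<in> carrier R"
  by (auto simp: character_group_def hom_def Pi_iff units_of_def intro!: Units_closed)

lemma character_mult:
  "\<lbrakk>\<chi> \<in> carrier (character_group R \<Gamma>); g \<in> carrier \<Gamma>; h \<in> carrier \<Gamma>\<rbrakk>
    \<Longrightarrow> \<chi> (g \<otimes>\<^bsub>\<Gamma>\<^esub> h) = \<chi> g \<otimes>\<^bsub>R\<^esub> \<chi> h"
  by (auto simp: character_group_def hom_def units_of_def)

locale finite_decomposition_algebra =
  nonassoc_algebra R A + \<Gamma>: group \<Gamma>
  for R :: "('r, 'm) ring_scheme" (structure) and A :: "('r, 'a, 'n) module_scheme" (structure)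
    and \<Gamma> :: "('g, 'p) monoid_scheme" +
  fixes I :: "'i set" and \<Omega> :: "'i \<Rightarrow> 'g \<Rightarrow> 'a set" and Y :: "('g \<Rightarrow> 'r) set"
  assumes finite_degrees: "finite (carrier \<Gamma>)"
    and decompositions: "i \<in> I \<Longrightarrow> algebra_decomposition R \<Gamma> A (\<Omega> i)"
    and subgroup_Y: "subgroup Y (character_group R \<Gamma>)"
begin

abbreviation Y_group :: "('g \<Rightarrow> 'r) monoid" where
  "Y_group \<equiv> (character_group R \<Gamma>)\<lparr>carrier := Y\<rparr>"

abbreviation \<tau> :: "'i \<Rightarrow> ('g \<Rightarrow> 'r) \<Rightarrow> 'a \<Rightarrow> 'a" where
  "\<tau> \<equiv> miyamoto_map R \<Gamma> A \<Omega>"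

lemma finite_decomposition: "i \<in> I \<Longrightarrow> finite_decomposition R A \<Gamma> (\<Omega> i)"
  using nonassoc_algebra_axioms \<Gamma>.group_axioms finite_degrees decompositions
  by (simp add: finite_decomposition_def finite_decomposition_axioms_def)

lemma character: "\<chi> \<in> Y \<Longrightarrow> \<chi> \<in> carrier (character_group R \<Gamma>)"
  using subgroup.mem_carrier[OF subgroup_Y] .

lemma character_value: "\<lbrakk>\<chi> \<in> Y; g \<in> carrier \<Gamma>\<rbrakk> \<Longrightarrow> \<chi> g \<in> carrier R"
  by (rule character_closed[OF character])

lemma group_Y: "group Y_group"
  by (rule subgroup.subgroup_is_group[OF subgroup_Y group_character_group[OF is_cring \<Gamma>.group_axioms]])

text \<open>
  Existence of the map specified by the description operator is the scaling construction, and
  uniqueness holds because linear maps are determined on the parts.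
\<close>

lemma miyamoto_map:
  assumes i: "i \<in> I" and \<chi>: "\<chi> \<in> Y"
  shows "\<tau> i \<chi> \<in> linear_maps R A A" and "\<tau> i \<chi> \<in> extensional (carrier A)"
    and "\<lbrakk>g \<in> carrier \<Gamma>; a \<in> \<Omega> i g\<rbrakk> \<Longrightarrow> \<tau> i \<chi> a = \<chi> g \<odot>\<^bsub>A\<^esub> a"
proof -
  interpret finite_decomposition R A \<Gamma> "\<Omega> i" by (rule finite_decomposition[OF i])
  let ?P = "\<lambda>f. f \<in> linear_maps R A A \<inter> extensional (carrier A) \<and>
        (\<forall>g \<in> carrier \<Gamma>. \<forall>a \<in> \<Omega> i g. f a = \<chi> g \<odot>\<^bsub>A\<^esub> a)"
  have "\<exists>f. ?P f"
    using ex_scaling_map[of \<chi>] character_value[OF \<chi>] by blast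
  moreover have "f = f'" if "?P f" "?P f'" for f f'
  proof (rule extensionalityI[of _ "carrier A"])
    show "f a = f' a" if "a \<in> carrier A" for a
      using linear_maps_eq_on_parts[OF module_axioms, of f f'] \<open>?P f\<close> \<open>?P f'\<close> that by simp
  qed (use that in auto)
  ultimately have "\<exists>!f. ?P f" by (rule ex_ex1I)
  then have "?P (\<tau> i \<chi>)" unfolding miyamoto_map_def by (rule theI')
  then show "\<tau> i \<chi> \<in> linear_maps R A A" "\<tau> i \<chi> \<in> extensional (carrier A)"
    "\<lbrakk>g \<in> carrier \<Gamma>; a \<in> \<Omega> i g\<rbrakk> \<Longrightarrow> \<tau> i \<chi> a = \<chi> g \<odot>\<^bsub>A\<^esub> a" by auto
qed

text \<open>
  Both sides of \<open>\<tau> (x y) = \<tau> x \<cdot> \<tau> y\<close> are linear in each variable, so it suffices to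
  compare them on homogeneous elements, where \<open>\<chi> (g h) = \<chi> g \<cdot> \<chi> h\<close> decides.
\<close>

lemma miyamoto_map_mult:
  assumes i: "i \<in> I" and \<chi>: "\<chi> \<in> Y" and x: "x \<in> carrier A" and y: "y \<in> carrier A"
  shows "\<tau> i \<chi> (x \<otimes>\<^bsub>A\<^esub> y) = \<tau> i \<chi> x \<otimes>\<^bsub>A\<^esub> \<tau> i \<chi> y"
proof -
  interpret finite_decomposition R A \<Gamma> "\<Omega> i" by (rule finite_decomposition[OF i])
  note \<tau> = miyamoto_map[OF i \<chi>]
  note \<tau>_closed = linear_mapsD(1)[OF \<tau>(1)]
  have left: "(\<lambda>y. a \<otimes>\<^bsub>A\<^esub> y) \<in> linear_maps R A A" if "a \<in> carrier A" for a
    using that by (simp add: linear_maps_def amult_closed amult_r_distr amult_r_smult)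
  have right: "(\<lambda>x. x \<otimes>\<^bsub>A\<^esub> a) \<in> linear_maps R A A" if "a \<in> carrier A" for a
    using that by (simp add: linear_maps_def amult_closed amult_l_distr amult_l_smult)
  have homogeneous: "\<tau> i \<chi> (a \<otimes>\<^bsub>A\<^esub> y) = \<tau> i \<chi> a \<otimes>\<^bsub>A\<^esub> \<tau> i \<chi> y"
    if g: "g \<in> carrier \<Gamma>" and a: "a \<in> \<Omega> i g" and y: "y \<in> carrier A" for g a y
  proof (rule linear_maps_eq_on_parts[OF module_axioms _ _ _ y])
    have aA: "a \<in> carrier A" using part_closed[OF g a] .
    show "(\<lambda>y. \<tau> i \<chi> (a \<otimes>\<^bsub>A\<^esub> y)) \<in> linear_maps R A A"
      by (rule linear_maps_compose[OF left[OF aA] \<tau>(1)])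
    show "(\<lambda>y. \<tau> i \<chi> a \<otimes>\<^bsub>A\<^esub> \<tau> i \<chi> y) \<in> linear_maps R A A"
      by (rule linear_maps_compose[OF \<tau>(1) left[OF \<tau>_closed[OF aA]]])
    fix h b assume h: "h \<in> carrier \<Gamma>" and b: "b \<in> \<Omega> i h"
    have bA: "b \<in> carrier A" using part_closed[OF h b] .
    have gh: "g \<otimes>\<^bsub>\<Gamma>\<^esub> h \<in> carrier \<Gamma>" using g h by simp
    have "\<tau> i \<chi> (a \<otimes>\<^bsub>A\<^esub> b) = (\<chi> g \<otimes>\<^bsub>R\<^esub> \<chi> h) \<odot>\<^bsub>A\<^esub> (a \<otimes>\<^bsub>A\<^esub> b)"
      using \<tau>(3)[OF gh part_mult[OF g h a b]] character_mult[OF character[OF \<chi>] g h] by simp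
    also have "\<dots> = \<chi> g \<odot>\<^bsub>A\<^esub> (a \<otimes>\<^bsub>A\<^esub> (\<chi> h \<odot>\<^bsub>A\<^esub> b))"
      using aA bA character_value[OF \<chi> g] character_value[OF \<chi> h]
      by (simp add: smult_assoc1 amult_r_smult amult_closed)
    also have "\<dots> = \<tau> i \<chi> a \<otimes>\<^bsub>A\<^esub> \<tau> i \<chi> b"
      using \<tau>(3)[OF g a] \<tau>(3)[OF h b] aA bA character_value[OF \<chi> g] character_value[OF \<chi> h]
      by (simp add: amult_l_smult)
    finally show "\<tau> i \<chi> (a \<otimes>\<^bsub>A\<^esub> b) = \<tau> i \<chi> a \<otimes>\<^bsub>A\<^esub> \<tau> i \<chi> b" .
  qed
  show ?thesis
  proof (rule linear_maps_eq_on_parts[OF module_axioms _ _ _ x])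
    show "(\<lambda>x. \<tau> i \<chi> (x \<otimes>\<^bsub>A\<^esub> y)) \<in> linear_maps R A A"
      by (rule linear_maps_compose[OF right[OF y] \<tau>(1)])
    show "(\<lambda>x. \<tau> i \<chi> x \<otimes>\<^bsub>A\<^esub> \<tau> i \<chi> y) \<in> linear_maps R A A"
      by (rule linear_maps_compose[OF \<tau>(1) right[OF \<tau>_closed[OF y]]])
  qed (rule homogeneous[OF _ _ y])
qed

text \<open>
  On the part of degree \<open>g\<close> the composite acts as \<open>\<chi>' g \<cdot> \<chi> g = 1\<close>. Applied to \<open>\<chi>\<close> and its inverse
  in both orders, this shows that Miyamoto maps are bijective.
\<close>

lemma miyamoto_map_cancel:
  assumes i: "i \<in> I" and \<chi>: "\<chi> \<in> Y" and \<chi>': "\<chi>' \<in> Y"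
    and inverse: "\<chi>' \<otimes>\<^bsub>character_group R \<Gamma>\<^esub> \<chi> = \<one>\<^bsub>character_group R \<Gamma>\<^esub>" and a: "a \<in> carrier A"
  shows "\<tau> i \<chi>' (\<tau> i \<chi> a) = a"
proof -
  interpret finite_decomposition R A \<Gamma> "\<Omega> i" by (rule finite_decomposition[OF i])
  note \<tau> = miyamoto_map[OF i \<chi>] and \<tau>' = miyamoto_map[OF i \<chi>']
  show ?thesis
  proof (rule linear_maps_eq_on_parts[OF module_axioms _ _ _ a])
    show "(\<lambda>a. \<tau> i \<chi>' (\<tau> i \<chi> a)) \<in> linear_maps R A A"
      by (rule linear_maps_compose[OF \<tau>(1) \<tau>'(1)])
    show "(\<lambda>a. a) \<in> linear_maps R A A" by (simp add: linear_maps_def)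
    fix g a assume g: "g \<in> carrier \<Gamma>" and a: "a \<in> \<Omega> i g"
    have "\<chi>' g \<otimes>\<^bsub>R\<^esub> \<chi> g = \<one>\<^bsub>R\<^esub>"
      using g fun_cong[OF inverse, of g] by (simp add: character_group_def)
    then have "\<chi> g \<otimes>\<^bsub>R\<^esub> \<chi>' g = \<one>\<^bsub>R\<^esub>"
      using character_value[OF \<chi> g] character_value[OF \<chi>' g] by (simp add: R.m_comm)
    then show "\<tau> i \<chi>' (\<tau> i \<chi> a) = a"
      using part_closed[OF g a] \<tau>(3)[OF g a] \<tau>'(3)[OF g a] linear_mapsD(3)[OF \<tau>'(1)]
        character_value[OF \<chi> g] character_value[OF \<chi>' g] by (simp flip: smult_assoc1)
  qed
qed

lemma miyamoto_map_Aut: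
  assumes i: "i \<in> I" and \<chi>: "\<chi> \<in> Y"
  shows "\<tau> i \<chi> \<in> carrier (algebra_Aut R A)"
proof -
  note group_X = group_character_group[OF is_cring \<Gamma>.group_axioms]
  let ?\<chi>' = "inv\<^bsub>character_group R \<Gamma>\<^esub> \<chi>"
  have \<chi>': "?\<chi>' \<in> Y" using subgroup.m_inv_closed[OF subgroup_Y \<chi>] .
  note \<chi>X = character[OF \<chi>]
  have "bij_betw (\<tau> i \<chi>) (carrier A) (carrier A)"
  proof (rule bij_betwI)
    show "\<tau> i \<chi> \<in> carrier A \<rightarrow> carrier A" "\<tau> i ?\<chi>' \<in> carrier A \<rightarrow> carrier A"
      using linear_mapsD(1)[OF miyamoto_map(1)[OF i \<chi>]]
        linear_mapsD(1)[OF miyamoto_map(1)[OF i \<chi>']] by blast+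
    show "\<tau> i ?\<chi>' (\<tau> i \<chi> a) = a" if "a \<in> carrier A" for a
      by (rule miyamoto_map_cancel[OF i \<chi> \<chi>' group.l_inv[OF group_X \<chi>X] that])
    show "\<tau> i \<chi> (\<tau> i ?\<chi>' a) = a" if "a \<in> carrier A" for a
      by (rule miyamoto_map_cancel[OF i \<chi>' \<chi> group.r_inv[OF group_X \<chi>X] that])
  qed
  then show ?thesis
    using miyamoto_map(1,2)[OF i \<chi>] miyamoto_map_mult[OF i \<chi>]
    by (simp add: carrier_algebra_Aut Bij_def algebra_homs_def)
qed

lemma miyamoto_generators_Aut:
  "{\<tau> i \<chi> | i \<chi>. i \<in> I \<and> \<chi> \<in> Y} \<subseteq> carrier (algebra_Aut R A)"
  using miyamoto_map_Aut by blast

lemma subgroup_miyamoto_group: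
  "subgroup (carrier (miyamoto_group R \<Gamma> Y A I \<Omega>)) (algebra_Aut R A)"
  using group.generate_is_subgroup[OF group_algebra_Aut miyamoto_generators_Aut]
  by (simp add: miyamoto_group_def)

lemma group_miyamoto_group: "group (miyamoto_group R \<Gamma> Y A I \<Omega>)"
  using subgroup.subgroup_is_group[OF subgroup_miyamoto_group group_algebra_Aut]
  by (simp add: miyamoto_group_def)

end

section \<open>The universal Miyamoto group\<close>

context finite_decomposition_algebra
begin

sublocale Y_copies: group_family I "\<lambda>_. Y_group"
  by (rule group_family.intro) (rule group_Y)

abbreviation F :: "('i \<times> ('g \<Rightarrow> 'r)) list set monoid" where
  "F \<equiv> miyamoto_free_product R \<Gamma> Y I"

abbreviation letter :: "'i \<Rightarrow> ('g \<Rightarrow> 'r) \<Rightarrow> ('i \<times> ('g \<Rightarrow> 'r)) list set" where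
  "letter \<equiv> miyamoto_letter R \<Gamma> Y I"

abbreviation relators :: "('i \<times> ('g \<Rightarrow> 'r)) list set set" where
  "relators \<equiv> miyamoto_relators R \<Gamma> Y A I \<Omega>"

abbreviation U :: "('i \<times> ('g \<Rightarrow> 'r)) list set set monoid" where
  "U \<equiv> universal_miyamoto_group R \<Gamma> Y A I \<Omega>"

abbreviation gen :: "'i \<Rightarrow> ('g \<Rightarrow> 'r) \<Rightarrow> ('i \<times> ('g \<Rightarrow> 'r)) list set set" where
  "gen \<equiv> universal_miyamoto_gen R \<Gamma> Y A I \<Omega>"

lemma group_F: "group F"
  unfolding miyamoto_free_product_def by (rule Y_copies.group_free_product)

lemma letter_hom: "i \<in> I \<Longrightarrow> letter i \<in> hom Y_group F"
  using Y_copies.free_product_incl_hom[of i]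
  by (simp add: miyamoto_free_product_def miyamoto_letter_def[abs_def])

lemma letter_closed: "\<lbrakk>i \<in> I; \<chi> \<in> Y\<rbrakk> \<Longrightarrow> letter i \<chi> \<in> carrier F"
  using hom_in_carrier[OF letter_hom, of i \<chi>] by simp

lemma conj_pairs_index:
  "(j, k) \<in> miyamoto_conj_pairs R \<Gamma> Y A I \<Omega> \<alpha> \<Longrightarrow> j \<in> I \<and> k \<in> I"
  by (simp add: miyamoto_conj_pairs_def)

lemma relators_carrier: "relators \<subseteq> carrier F"
proof -
  interpret F: group F by (rule group_F)
  show ?thesis
    by (auto simp: miyamoto_relators_def Let_def letter_closed dest!: conj_pairs_index)
qed

lemma normal_relators: "normal_closure F relators \<lhd> F"
  by (rule group.normal_closure_normal[OF group_F relators_carrier])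

lemma U_eq: "U = F Mod normal_closure F relators"
  by (simp add: universal_miyamoto_group_def Let_def)

lemma gen_eq: "gen i \<chi> = normal_closure F relators #>\<^bsub>F\<^esub> letter i \<chi>"
  by (simp add: universal_miyamoto_gen_def Let_def)

lemma group_U: "group U"
  unfolding U_eq by (rule normal.factorgroup_is_group[OF normal_relators])

lemma quotient_hom: "group_hom F U (\<lambda>w. normal_closure F relators #>\<^bsub>F\<^esub> w)"
  using group_F group_U normal.r_coset_hom_Mod[OF normal_relators]
  by (simp add: group_hom_def group_hom_axioms_def U_eq)

lemma gen_hom:
  assumes "i \<in> I"
  shows "gen i \<in> hom Y_group U"
proof -
  have "gen i = (\<lambda>w. normal_closure F relators #>\<^bsub>F\<^esub> w) \<circ> letter i"
    by (simp add: fun_eq_iff gen_eq)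
  then show ?thesis
    using hom_compose[OF letter_hom[OF assms] group_hom.homh[OF quotient_hom]] by simp
qed

lemma gen_relation:
  assumes i: "i \<in> I" and \<chi>: "\<chi> \<in> Y" and \<chi>': "\<chi>' \<in> Y"
    and jk: "(j, k) \<in> miyamoto_conj_pairs R \<Gamma> Y A I \<Omega> (\<tau> i \<chi>)"
  shows "gen i \<chi> \<otimes>\<^bsub>U\<^esub> gen j \<chi>' \<otimes>\<^bsub>U\<^esub> inv\<^bsub>U\<^esub> (gen i \<chi>) \<otimes>\<^bsub>U\<^esub> inv\<^bsub>U\<^esub> (gen k \<chi>') = \<one>\<^bsub>U\<^esub>"
proof -
  interpret q: group_hom F U "\<lambda>w. normal_closure F relators #>\<^bsub>F\<^esub> w" by (rule quotient_hom)
  let ?s = "letter i \<chi> \<otimes>\<^bsub>F\<^esub> letter j \<chi>' \<otimes>\<^bsub>F\<^esub> inv\<^bsub>F\<^esub> (letter i \<chi>) \<otimes>\<^bsub>F\<^esub> inv\<^bsub>F\<^esub> (letter k \<chi>')"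
  have "?s \<in> relators"
    unfolding miyamoto_relators_def Let_def using assms by blast
  then have "?s \<in> normal_closure F relators"
    using q.G.subset_normal_closure[OF relators_carrier] by blast
  then have "normal_closure F relators #>\<^bsub>F\<^esub> ?s = normal_closure F relators"
    by (rule subgroup.rcos_const[OF normal_imp_subgroup[OF normal_relators] group_F])
  also have "\<dots> = \<one>\<^bsub>U\<^esub>" by (simp add: U_eq)
  finally show ?thesis
    using letter_closed \<chi> \<chi>' i conj_pairs_index[OF jk] by (simp add: gen_eq)
qed

text \<open>
  The homomorphisms \<open>h i\<close> assemble to one on the free product, which descends to the quotient
  because the assumed relations say exactly that it kills the relators.
\<close>

lemma U_universal:
  assumes "group K" and hom: "\<And>i. i \<in> I \<Longrightarrow> h i \<in> hom Y_group K"
    and rel: "\<And>i j k \<chi> \<chi>'. \<lbrakk>i \<in> I; \<chi> \<in> Y; \<chi>' \<in> Y;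
        (j, k) \<in> miyamoto_conj_pairs R \<Gamma> Y A I \<Omega> (\<tau> i \<chi>)\<rbrakk>
      \<Longrightarrow> h i \<chi> \<otimes>\<^bsub>K\<^esub> h j \<chi>' \<otimes>\<^bsub>K\<^esub> inv\<^bsub>K\<^esub> (h i \<chi>) \<otimes>\<^bsub>K\<^esub> inv\<^bsub>K\<^esub> (h k \<chi>') = \<one>\<^bsub>K\<^esub>"
  obtains f where "f \<in> hom U K" and "\<And>i \<chi>. \<lbrakk>i \<in> I; \<chi> \<in> Y\<rbrakk> \<Longrightarrow> f (gen i \<chi>) = h i \<chi>"
proof -
  interpret group_family_homs I "\<lambda>_. Y_group" K h
    using Y_copies.group_family_axioms \<open>group K\<close> hom
    by (simp add: group_family_homs_def group_family_homs_axioms_def)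
  obtain f where f: "f \<in> hom F K" and f_letter: "\<And>i \<chi>. \<lbrakk>i \<in> I; \<chi> \<in> Y\<rbrakk> \<Longrightarrow> f (letter i \<chi>) = h i \<chi>"
  proof (rule free_product_universal)
    fix f assume "f \<in> hom (free_product I (\<lambda>_. Y_group)) K"
      and "\<And>i \<chi>. \<lbrakk>i \<in> I; \<chi> \<in> carrier Y_group\<rbrakk>
        \<Longrightarrow> f (free_product_incl I (\<lambda>_. Y_group) i \<chi>) = h i \<chi>"
    then show thesis
      by (intro that[of f]) (simp_all add: miyamoto_free_product_def miyamoto_letter_def)
  qed
  interpret f: group_hom F K f
    using group_F \<open>group K\<close> f by (simp add: group_hom_def group_hom_axioms_def)
  have "f s = \<one>\<^bsub>K\<^esub>" if "s \<in> relators" for s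
  proof -
    obtain i \<chi> j k \<chi>' where s: "s = letter i \<chi> \<otimes>\<^bsub>F\<^esub> letter j \<chi>' \<otimes>\<^bsub>F\<^esub> inv\<^bsub>F\<^esub> (letter i \<chi>) \<otimes>\<^bsub>F\<^esub> inv\<^bsub>F\<^esub> (letter k \<chi>')"
      and i: "i \<in> I" and \<chi>: "\<chi> \<in> Y" "\<chi>' \<in> Y"
      and jk: "(j, k) \<in> miyamoto_conj_pairs R \<Gamma> Y A I \<Omega> (\<tau> i \<chi>)"
      using \<open>s \<in> relators\<close> by (auto simp: miyamoto_relators_def Let_def)
    then show ?thesis
      using rel[OF i \<chi> jk] conj_pairs_index[OF jk] by (simp add: letter_closed f_letter)
  qed
  then obtain f' where "f' \<in> hom U K"
    and "\<And>w. w \<in> carrier F \<Longrightarrow> f' (normal_closure F relators #>\<^bsub>F\<^esub> w) = f w"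
    using f.normal_closure_quotient_universal[OF relators_carrier] unfolding U_eq by blast
  then show thesis
    using f_letter letter_closed by (intro that[of f']) (simp_all add: gen_eq)
qed

end

section \<open>Functoriality along surjective morphisms\<close>

locale surjective_decomposition_morphism =
  A: finite_decomposition_algebra R A \<Gamma> I \<Omega>\<^sub>A Y + B: finite_decomposition_algebra R B \<Gamma> J \<Omega>\<^sub>B Y
  for R :: "('r, 'm) ring_scheme" and \<Gamma> :: "('g, 'p) monoid_scheme" and Y :: "('g \<Rightarrow> 'r) set"
    and A :: "('r, 'a, 'n) module_scheme" and I :: "'i set" and \<Omega>\<^sub>A :: "'i \<Rightarrow> 'g \<Rightarrow> 'a set"
    and B :: "('r, 'b, 'k) module_scheme" and J :: "'j set" and \<Omega>\<^sub>B :: "'j \<Rightarrow> 'g \<Rightarrow> 'b set" +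
  fixes \<phi> :: "'a \<Rightarrow> 'b" and \<psi> :: "'i \<Rightarrow> 'j"
  assumes morphism: "decomposition_algebra_morphism R \<Gamma> A I \<Omega>\<^sub>A B J \<Omega>\<^sub>B \<phi> \<psi>"
    and surjective: "\<phi> ` carrier A = carrier B"
begin

lemma linear_\<phi>: "\<phi> \<in> linear_maps R A B"
  using morphism by (simp add: decomposition_algebra_morphism_def linear_algebra_hom)

lemma index_closed: "i \<in> I \<Longrightarrow> \<psi> i \<in> J"
  using morphism by (auto simp: decomposition_algebra_morphism_def)

lemma maps_parts: "\<lbrakk>i \<in> I; g \<in> carrier \<Gamma>; a \<in> \<Omega>\<^sub>A i g\<rbrakk> \<Longrightarrow> \<phi> a \<in> \<Omega>\<^sub>B (\<psi> i) g"
  using morphism unfolding decomposition_algebra_morphism_def by blast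

lemma \<phi>_closed: "a \<in> carrier A \<Longrightarrow> \<phi> a \<in> carrier B"
  using linear_mapsD(1)[OF linear_\<phi>] .

text \<open>
  Transport of automorphisms along \<open>\<phi>\<close> is treated as a relation first: it is visibly compatible
  with the group operations, and surjectivity of \<open>\<phi>\<close> makes it single-valued.
\<close>

definition intertwines :: "('a \<Rightarrow> 'a) \<Rightarrow> ('b \<Rightarrow> 'b) \<Rightarrow> bool" where
  "intertwines \<alpha> \<beta> \<longleftrightarrow> (\<forall>a \<in> carrier A. \<phi> (\<alpha> a) = \<beta> (\<phi> a))"

lemma intertwines_unique:
  assumes "intertwines \<alpha> \<beta>" and "intertwines \<alpha> \<beta>'"
    and "\<beta> \<in> extensional (carrier B)" and "\<beta>' \<in> extensional (carrier B)"
  shows "\<beta> = \<beta>'"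
proof (rule extensionalityI[OF assms(3,4)])
  fix b assume "b \<in> carrier B"
  then obtain a where "a \<in> carrier A" "b = \<phi> a" using surjective by blast
  then show "\<beta> b = \<beta>' b" using assms(1,2) by (metis intertwines_def)
qed

lemma intertwines_one: "intertwines \<one>\<^bsub>algebra_Aut R A\<^esub> \<one>\<^bsub>algebra_Aut R B\<^esub>"
  by (simp add: intertwines_def A.algebra_Aut_apply B.algebra_Aut_apply \<phi>_closed)

lemma intertwines_mult:
  assumes "intertwines \<alpha> \<beta>" and "intertwines \<alpha>' \<beta>'"
    and "\<alpha> \<in> carrier (algebra_Aut R A)" "\<alpha>' \<in> carrier (algebra_Aut R A)"
    and "\<beta> \<in> carrier (algebra_Aut R B)" "\<beta>' \<in> carrier (algebra_Aut R B)"
  shows "intertwines (\<alpha> \<otimes>\<^bsub>algebra_Aut R A\<^esub> \<alpha>') (\<beta> \<otimes>\<^bsub>algebra_Aut R B\<^esub> \<beta>')"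
  using assms
  by (simp add: intertwines_def A.algebra_Aut_apply B.algebra_Aut_apply \<phi>_closed A.algebra_Aut_closed)

lemma intertwines_inv:
  assumes "intertwines \<alpha> \<beta>"
    and \<alpha>: "\<alpha> \<in> carrier (algebra_Aut R A)" and \<beta>: "\<beta> \<in> carrier (algebra_Aut R B)"
  shows "intertwines (inv\<^bsub>algebra_Aut R A\<^esub> \<alpha>) (inv\<^bsub>algebra_Aut R B\<^esub> \<beta>)"
  unfolding intertwines_def
proof
  fix a assume a: "a \<in> carrier A"
  let ?a' = "(inv\<^bsub>algebra_Aut R A\<^esub> \<alpha>) a"
  have a': "?a' \<in> carrier A"
    using A.algebra_Aut_closed[OF group.inv_closed[OF A.group_algebra_Aut \<alpha>] a] .
  have "\<phi> a = \<beta> (\<phi> ?a')"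
    using assms(1) a' A.algebra_Aut_inv_apply(1)[OF \<alpha> a] by (metis intertwines_def)
  then show "\<phi> ?a' = (inv\<^bsub>algebra_Aut R B\<^esub> \<beta>) (\<phi> a)"
    using B.algebra_Aut_inv_apply(2)[OF \<beta> \<phi>_closed[OF a']] by simp
qed

text \<open>
  On an element \<open>a\<close> of degree \<open>g\<close> both composites give \<open>\<chi> g \<cdot> \<phi> a\<close>, since \<open>\<phi> a\<close> has degree \<open>g\<close>
  with respect to the index \<open>\<psi> i\<close>. Linearity extends this to the whole algebra.
\<close>

lemma intertwines_miyamoto_map:
  assumes i: "i \<in> I" and \<chi>: "\<chi> \<in> Y"
  shows "intertwines (miyamoto_map R \<Gamma> A \<Omega>\<^sub>A i \<chi>) (miyamoto_map R \<Gamma> B \<Omega>\<^sub>B (\<psi> i) \<chi>)"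
  unfolding intertwines_def
proof
  interpret Ai: finite_decomposition R A \<Gamma> "\<Omega>\<^sub>A i" by (rule A.finite_decomposition[OF i])
  note \<tau>A = A.miyamoto_map[OF i \<chi>] and \<tau>B = B.miyamoto_map[OF index_closed[OF i] \<chi>]
  fix a assume "a \<in> carrier A"
  then show "\<phi> (miyamoto_map R \<Gamma> A \<Omega>\<^sub>A i \<chi> a) = miyamoto_map R \<Gamma> B \<Omega>\<^sub>B (\<psi> i) \<chi> (\<phi> a)"
  proof (rule Ai.linear_maps_eq_on_parts[rotated -1])
    show "module R B" by (rule B.module_axioms)
    show "(\<lambda>a. \<phi> (miyamoto_map R \<Gamma> A \<Omega>\<^sub>A i \<chi> a)) \<in> linear_maps R A B"
      by (rule linear_maps_compose[OF \<tau>A(1) linear_\<phi>])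
    show "(\<lambda>a. miyamoto_map R \<Gamma> B \<Omega>\<^sub>B (\<psi> i) \<chi> (\<phi> a)) \<in> linear_maps R A B"
      by (rule linear_maps_compose[OF linear_\<phi> \<tau>B(1)])
    fix g a assume g: "g \<in> carrier \<Gamma>" and a: "a \<in> \<Omega>\<^sub>A i g"
    then show "\<phi> (miyamoto_map R \<Gamma> A \<Omega>\<^sub>A i \<chi> a) = miyamoto_map R \<Gamma> B \<Omega>\<^sub>B (\<psi> i) \<chi> (\<phi> a)"
      using \<tau>A(3)[OF g a] \<tau>B(3)[OF g maps_parts[OF i g a]] Ai.part_closed[OF g a]
        A.character_value[OF \<chi> g] linear_mapsD(3)[OF linear_\<phi>] by simp
  qed
qed

text \<open>
  An explicit formula for the intertwined partner of \<open>\<alpha>\<close>. The choice of preimage under \<open>\<phi>\<close> is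
  immaterial as soon as a partner exists, which is the case on the Miyamoto group.
\<close>

definition induced :: "('a \<Rightarrow> 'a) \<Rightarrow> 'b \<Rightarrow> 'b" where
  "induced \<alpha> = (\<lambda>b \<in> carrier B. \<phi> (\<alpha> (inv_into (carrier A) \<phi> b)))"

lemma induced_eq:
  assumes "intertwines \<alpha> \<beta>" and "\<beta> \<in> extensional (carrier B)"
  shows "induced \<alpha> = \<beta>"
proof (rule extensionalityI[of _ "carrier B"])
  fix b assume b: "b \<in> carrier B"
  then have "inv_into (carrier A) \<phi> b \<in> carrier A" "\<phi> (inv_into (carrier A) \<phi> b) = b"
    using surjective by (auto simp: inv_into_into f_inv_into_f)
  then show "induced \<alpha> b = \<beta> b"
    using b assms(1) by (simp add: induced_def intertwines_def)
qed (use assms(2) in \<open>auto simp: induced_def\<close>)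

text \<open>
  The generators have partners by the previous computation, and the automorphisms with a partner
  in a given subgroup are closed under products and inverses.
\<close>

lemma ex_intertwiner:
  assumes "\<alpha> \<in> carrier (miyamoto_group R \<Gamma> Y A I \<Omega>\<^sub>A)"
  shows "\<exists>\<beta> \<in> carrier (miyamoto_group R \<Gamma> Y B J \<Omega>\<^sub>B). intertwines \<alpha> \<beta>"
proof -
  let ?S = "{miyamoto_map R \<Gamma> A \<Omega>\<^sub>A i \<chi> | i \<chi>. i \<in> I \<and> \<chi> \<in> Y}"
  let ?M = "carrier (miyamoto_group R \<Gamma> Y B J \<Omega>\<^sub>B)"
  have M: "subgroup ?M (algebra_Aut R B)" by (rule B.subgroup_miyamoto_group)
  have S_Aut: "generate (algebra_Aut R A) ?S \<subseteq> carrier (algebra_Aut R A)"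
    by (rule group.generate_incl[OF A.group_algebra_Aut A.miyamoto_generators_Aut])
  have gen: "\<exists>\<beta> \<in> ?M. intertwines \<alpha> \<beta>" if "\<alpha> \<in> ?S" for \<alpha>
  proof -
    obtain i \<chi> where "i \<in> I" "\<chi> \<in> Y" "\<alpha> = miyamoto_map R \<Gamma> A \<Omega>\<^sub>A i \<chi>" using \<open>\<alpha> \<in> ?S\<close> by blast
    moreover from this have "miyamoto_map R \<Gamma> B \<Omega>\<^sub>B (\<psi> i) \<chi> \<in> ?M"
      using index_closed by (auto simp: miyamoto_group_def intro!: generate.incl)
    ultimately show ?thesis using intertwines_miyamoto_map by blast
  qed
  have "\<alpha> \<in> generate (algebra_Aut R A) ?S"
    using assms by (simp add: miyamoto_group_def)
  then show ?thesis
  proof induction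
    case one
    then show ?case using intertwines_one subgroup.one_closed[OF M] by blast
  next
    case (incl \<alpha>)
    then show ?case by (rule gen)
  next
    case (inv \<alpha>)
    then obtain \<beta> where \<beta>: "\<beta> \<in> ?M" "intertwines \<alpha> \<beta>" using gen by blast
    have "\<alpha> \<in> carrier (algebra_Aut R A)" using inv A.miyamoto_generators_Aut by blast
    then show ?case
      using intertwines_inv[OF \<beta>(2)] \<beta>(1) subgroup.m_inv_closed[OF M] subgroup.mem_carrier[OF M] by blast
  next
    case (eng \<alpha> \<alpha>')
    then obtain \<beta> \<beta>' where \<beta>: "\<beta> \<in> ?M" "intertwines \<alpha> \<beta>" "\<beta>' \<in> ?M" "intertwines \<alpha>' \<beta>'" by blast
    then have "intertwines (\<alpha> \<otimes>\<^bsub>algebra_Aut R A\<^esub> \<alpha>') (\<beta> \<otimes>\<^bsub>algebra_Aut R B\<^esub> \<beta>')"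
      using eng S_Aut subgroup.mem_carrier[OF M] by (intro intertwines_mult) auto
    then show ?case using subgroup.m_closed[OF M \<beta>(1,3)] by blast
  qed
qed

lemma miyamoto_group_Aut:
  "\<alpha> \<in> carrier (miyamoto_group R \<Gamma> Y A I \<Omega>\<^sub>A) \<Longrightarrow> \<alpha> \<in> carrier (algebra_Aut R A)"
  "\<beta> \<in> carrier (miyamoto_group R \<Gamma> Y B J \<Omega>\<^sub>B) \<Longrightarrow> \<beta> \<in> carrier (algebra_Aut R B)"
  using subgroup.mem_carrier[OF A.subgroup_miyamoto_group]
    subgroup.mem_carrier[OF B.subgroup_miyamoto_group] by blast+

lemma induced:
  assumes "\<alpha> \<in> carrier (miyamoto_group R \<Gamma> Y A I \<Omega>\<^sub>A)"
  shows "induced \<alpha> \<in> carrier (miyamoto_group R \<Gamma> Y B J \<Omega>\<^sub>B)" and "intertwines \<alpha> (induced \<alpha>)"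
proof -
  obtain \<beta> where "\<beta> \<in> carrier (miyamoto_group R \<Gamma> Y B J \<Omega>\<^sub>B)" "intertwines \<alpha> \<beta>"
    using ex_intertwiner[OF assms] by blast
  moreover from this have "induced \<alpha> = \<beta>"
    using B.algebra_Aut_extensional[OF miyamoto_group_Aut(2)] by (intro induced_eq)
  ultimately show "induced \<alpha> \<in> carrier (miyamoto_group R \<Gamma> Y B J \<Omega>\<^sub>B)" "intertwines \<alpha> (induced \<alpha>)"
    by simp_all
qed

lemma induced_hom:
  "induced \<in> hom (miyamoto_group R \<Gamma> Y A I \<Omega>\<^sub>A) (miyamoto_group R \<Gamma> Y B J \<Omega>\<^sub>B)"
proof (rule homI)
  fix \<alpha> \<alpha>' assume \<alpha>: "\<alpha> \<in> carrier (miyamoto_group R \<Gamma> Y A I \<Omega>\<^sub>A)" "\<alpha>' \<in> carrier (miyamoto_group R \<Gamma> Y A I \<Omega>\<^sub>A)"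
  have Aut: "induced \<alpha> \<in> carrier (algebra_Aut R B)" "induced \<alpha>' \<in> carrier (algebra_Aut R B)"
    using \<alpha>[THEN induced(1)] by (auto intro: miyamoto_group_Aut)
  have "induced (\<alpha> \<otimes>\<^bsub>algebra_Aut R A\<^esub> \<alpha>') = induced \<alpha> \<otimes>\<^bsub>algebra_Aut R B\<^esub> induced \<alpha>'"
  proof (rule induced_eq)
    show "intertwines (\<alpha> \<otimes>\<^bsub>algebra_Aut R A\<^esub> \<alpha>') (induced \<alpha> \<otimes>\<^bsub>algebra_Aut R B\<^esub> induced \<alpha>')"
      by (rule intertwines_mult[OF induced(2)[OF \<alpha>(1)] induced(2)[OF \<alpha>(2)]
            miyamoto_group_Aut(1)[OF \<alpha>(1)] miyamoto_group_Aut(1)[OF \<alpha>(2)] Aut])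
    show "induced \<alpha> \<otimes>\<^bsub>algebra_Aut R B\<^esub> induced \<alpha>' \<in> extensional (carrier B)"
      by (rule B.algebra_Aut_extensional[OF monoid.m_closed[OF group.is_monoid[OF B.group_algebra_Aut] Aut]])
  qed
  then show "induced (\<alpha> \<otimes>\<^bsub>miyamoto_group R \<Gamma> Y A I \<Omega>\<^sub>A\<^esub> \<alpha>')
      = induced \<alpha> \<otimes>\<^bsub>miyamoto_group R \<Gamma> Y B J \<Omega>\<^sub>B\<^esub> induced \<alpha>'"
    by (simp add: miyamoto_group_def)
qed (rule induced(1))

lemma induced_miyamoto_map:
  "\<lbrakk>i \<in> I; \<chi> \<in> Y\<rbrakk> \<Longrightarrow> induced (miyamoto_map R \<Gamma> A \<Omega>\<^sub>A i \<chi>) = miyamoto_map R \<Gamma> B \<Omega>\<^sub>B (\<psi> i) \<chi>"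
  by (rule induced_eq[OF intertwines_miyamoto_map B.miyamoto_map(2)[OF index_closed]])

text \<open>
  The conjugate of \<open>\<tau>\<close> for \<open>\<psi> j\<close> and the map \<open>\<tau>\<close> for \<open>\<psi> k\<close> are both partners of one and the same
  automorphism of \<open>A\<close>, hence equal. So \<open>\<psi>\<close> carries defining relations of the universal group of
  \<open>A\<close> to defining relations of that of \<open>B\<close>.
\<close>

lemma conj_pairs_image:
  assumes i: "i \<in> I" and \<chi>: "\<chi> \<in> Y"
    and jk: "(j, k) \<in> miyamoto_conj_pairs R \<Gamma> Y A I \<Omega>\<^sub>A (miyamoto_map R \<Gamma> A \<Omega>\<^sub>A i \<chi>)"
  shows "(\<psi> j, \<psi> k) \<in> miyamoto_conj_pairs R \<Gamma> Y B J \<Omega>\<^sub>B (miyamoto_map R \<Gamma> B \<Omega>\<^sub>B (\<psi> i) \<chi>)"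
proof -
  interpret AutA: group "algebra_Aut R A" by (rule A.group_algebra_Aut)
  interpret AutB: group "algebra_Aut R B" by (rule B.group_algebra_Aut)
  have j: "j \<in> I" and k: "k \<in> I" using A.conj_pairs_index[OF jk] by auto
  let ?\<alpha> = "miyamoto_map R \<Gamma> A \<Omega>\<^sub>A i \<chi>" and ?\<beta> = "miyamoto_map R \<Gamma> B \<Omega>\<^sub>B (\<psi> i) \<chi>"
  have \<alpha>\<beta>: "intertwines ?\<alpha> ?\<beta>" "?\<alpha> \<in> carrier (algebra_Aut R A)" "?\<beta> \<in> carrier (algebra_Aut R B)"
    using intertwines_miyamoto_map[OF i \<chi>] A.miyamoto_map_Aut[OF i \<chi>]
      B.miyamoto_map_Aut[OF index_closed[OF i] \<chi>] by auto
  have "?\<beta> \<otimes>\<^bsub>algebra_Aut R B\<^esub> miyamoto_map R \<Gamma> B \<Omega>\<^sub>B (\<psi> j) \<chi>' \<otimes>\<^bsub>algebra_Aut R B\<^esub> inv\<^bsub>algebra_Aut R B\<^esub> ?\<beta>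
      = miyamoto_map R \<Gamma> B \<Omega>\<^sub>B (\<psi> k) \<chi>'" if \<chi>': "\<chi>' \<in> Y" for \<chi>'
  proof -
    let ?\<tau>j = "miyamoto_map R \<Gamma> A \<Omega>\<^sub>A j \<chi>'" and ?\<tau>\<psi>j = "miyamoto_map R \<Gamma> B \<Omega>\<^sub>B (\<psi> j) \<chi>'"
    note Aut = \<alpha>\<beta>(2,3) A.miyamoto_map_Aut[OF j \<chi>'] B.miyamoto_map_Aut[OF index_closed[OF j] \<chi>']
    show ?thesis
    proof (rule intertwines_unique)
      show "intertwines (?\<alpha> \<otimes>\<^bsub>algebra_Aut R A\<^esub> ?\<tau>j \<otimes>\<^bsub>algebra_Aut R A\<^esub> inv\<^bsub>algebra_Aut R A\<^esub> ?\<alpha>)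
          (?\<beta> \<otimes>\<^bsub>algebra_Aut R B\<^esub> ?\<tau>\<psi>j \<otimes>\<^bsub>algebra_Aut R B\<^esub> inv\<^bsub>algebra_Aut R B\<^esub> ?\<beta>)"
        by (intro intertwines_mult intertwines_inv \<alpha>\<beta> intertwines_miyamoto_map j \<chi>'
            AutA.m_closed AutB.m_closed AutA.inv_closed AutB.inv_closed Aut)
      have "?\<alpha> \<otimes>\<^bsub>algebra_Aut R A\<^esub> ?\<tau>j \<otimes>\<^bsub>algebra_Aut R A\<^esub> inv\<^bsub>algebra_Aut R A\<^esub> ?\<alpha>
          = miyamoto_map R \<Gamma> A \<Omega>\<^sub>A k \<chi>'"
        using jk \<chi>' by (auto simp: miyamoto_conj_pairs_def)
      then show "intertwines (?\<alpha> \<otimes>\<^bsub>algebra_Aut R A\<^esub> ?\<tau>j \<otimes>\<^bsub>algebra_Aut R A\<^esub> inv\<^bsub>algebra_Aut R A\<^esub> ?\<alpha>)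
          (miyamoto_map R \<Gamma> B \<Omega>\<^sub>B (\<psi> k) \<chi>')"
        using intertwines_miyamoto_map[OF k \<chi>'] by simp
      show "?\<beta> \<otimes>\<^bsub>algebra_Aut R B\<^esub> ?\<tau>\<psi>j \<otimes>\<^bsub>algebra_Aut R B\<^esub> inv\<^bsub>algebra_Aut R B\<^esub> ?\<beta>
          \<in> extensional (carrier B)"
        by (intro B.algebra_Aut_extensional AutB.m_closed AutB.inv_closed Aut)
      show "miyamoto_map R \<Gamma> B \<Omega>\<^sub>B (\<psi> k) \<chi>' \<in> extensional (carrier B)"
        by (rule B.miyamoto_map(2)[OF index_closed[OF k] \<chi>'])
    qed
  qed
  then show ?thesis
    using index_closed[OF j] index_closed[OF k] by (simp add: miyamoto_conj_pairs_def)
qed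

lemma ex_universal_hom:
  "\<exists>\<theta>. group_hom (universal_miyamoto_group R \<Gamma> Y A I \<Omega>\<^sub>A) (universal_miyamoto_group R \<Gamma> Y B J \<Omega>\<^sub>B) \<theta> \<and>
    (\<forall>i \<in> I. \<forall>\<chi> \<in> Y. \<theta> (universal_miyamoto_gen R \<Gamma> Y A I \<Omega>\<^sub>A i \<chi>)
       = universal_miyamoto_gen R \<Gamma> Y B J \<Omega>\<^sub>B (\<psi> i) \<chi>)"
proof -
  let ?h = "\<lambda>i. universal_miyamoto_gen R \<Gamma> Y B J \<Omega>\<^sub>B (\<psi> i)"
  obtain \<theta> where "\<theta> \<in> hom (universal_miyamoto_group R \<Gamma> Y A I \<Omega>\<^sub>A) (universal_miyamoto_group R \<Gamma> Y B J \<Omega>\<^sub>B)"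
    and "\<And>i \<chi>. \<lbrakk>i \<in> I; \<chi> \<in> Y\<rbrakk> \<Longrightarrow> \<theta> (universal_miyamoto_gen R \<Gamma> Y A I \<Omega>\<^sub>A i \<chi>) = ?h i \<chi>"
  proof (rule A.U_universal[OF B.group_U, of ?h])
    show "?h i \<in> hom A.Y_group B.U" if "i \<in> I" for i
      by (rule B.gen_hom[OF index_closed[OF that]])
    show "?h i \<chi> \<otimes>\<^bsub>B.U\<^esub> ?h j \<chi>' \<otimes>\<^bsub>B.U\<^esub> inv\<^bsub>B.U\<^esub> (?h i \<chi>) \<otimes>\<^bsub>B.U\<^esub> inv\<^bsub>B.U\<^esub> (?h k \<chi>') = \<one>\<^bsub>B.U\<^esub>"
      if "i \<in> I" "\<chi> \<in> Y" "\<chi>' \<in> Y" "(j, k) \<in> miyamoto_conj_pairs R \<Gamma> Y A I \<Omega>\<^sub>A (A.\<tau> i \<chi>)"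
      for i j k \<chi> \<chi>'
      by (rule B.gen_relation[OF index_closed[OF that(1)] that(2,3) conj_pairs_image[OF that(1,2,4)]])
  qed blast
  then show ?thesis
    using A.group_U B.group_U by (auto simp: group_hom_def group_hom_axioms_def)
qed

end

theorem proposition6p9:
  fixes R :: "('r, 'm) ring_scheme"
    and \<Gamma> :: "('g, 'p) monoid_scheme"
    and Y :: "('g \<Rightarrow> 'r) set"
    and A :: "('r, 'a, 'n) module_scheme"
    and I :: "'i set"
    and \<Omega>\<^sub>A :: "'i \<Rightarrow> 'g \<Rightarrow> 'a set"
    and B :: "('r, 'b, 'k) module_scheme"
    and J :: "'j set"
    and \<Omega>\<^sub>B :: "'j \<Rightarrow> 'g \<Rightarrow> 'b set"
    and \<phi> :: "'a \<Rightarrow> 'b"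
    and \<psi> :: "'i \<Rightarrow> 'j"
  assumes "cring R"
    and "group \<Gamma>"
    and "finite (carrier \<Gamma>)"
    and "subgroup Y (character_group R \<Gamma>)"
    and "decomposition_algebra R \<Gamma> A I \<Omega>\<^sub>A"
    and "decomposition_algebra R \<Gamma> B J \<Omega>\<^sub>B"
    and "decomposition_algebra_morphism R \<Gamma> A I \<Omega>\<^sub>A B J \<Omega>\<^sub>B \<phi> \<psi>"
    and "\<phi> ` carrier A = carrier B"
  shows "(\<exists>\<theta>. group_hom (miyamoto_group R \<Gamma> Y A I \<Omega>\<^sub>A) (miyamoto_group R \<Gamma> Y B J \<Omega>\<^sub>B) \<theta> \<and>
            (\<forall>i \<in> I. \<forall>\<chi> \<in> Y. \<theta> (miyamoto_map R \<Gamma> A \<Omega>\<^sub>A i \<chi>) = miyamoto_map R \<Gamma> B \<Omega>\<^sub>B (\<psi> i) \<chi>)) \<and>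
         (miyamoto_closed R \<Gamma> Y A I \<Omega>\<^sub>A \<and> miyamoto_closed R \<Gamma> Y B J \<Omega>\<^sub>B \<longrightarrow>
          (\<exists>\<theta>'. group_hom (universal_miyamoto_group R \<Gamma> Y A I \<Omega>\<^sub>A)
                   (universal_miyamoto_group R \<Gamma> Y B J \<Omega>\<^sub>B) \<theta>' \<and>
            (\<forall>i \<in> I. \<forall>\<chi> \<in> Y. \<theta>' (universal_miyamoto_gen R \<Gamma> Y A I \<Omega>\<^sub>A i \<chi>)
               = universal_miyamoto_gen R \<Gamma> Y B J \<Omega>\<^sub>B (\<psi> i) \<chi>)))"
proof -
  interpret surjective_decomposition_morphism R \<Gamma> Y A I \<Omega>\<^sub>A B J \<Omega>\<^sub>B \<phi> \<psi>
    using assms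
    by (simp add: surjective_decomposition_morphism_def surjective_decomposition_morphism_axioms_def
        finite_decomposition_algebra_def finite_decomposition_algebra_axioms_def
        decomposition_algebra_def)
  have "group_hom (miyamoto_group R \<Gamma> Y A I \<Omega>\<^sub>A) (miyamoto_group R \<Gamma> Y B J \<Omega>\<^sub>B) induced"
    using induced_hom A.group_miyamoto_group B.group_miyamoto_group
    by (simp add: group_hom_def group_hom_axioms_def)
  then show ?thesis
    using induced_miyamoto_map ex_universal_hom by blast
qed

end
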